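(* Let $A\in\mathbb R^{n\times n}$ be symmetric positive definite with eigenvalues $0<\lambda_1<\lambda_2\le\dots\le\lambda_n$, let $x_i\in\mathbb R^n$ be nonzero, and let $\rho(x)=x^{\top}Ax/(x^{\top}x)$. Consider one step of the preconditioned inverse iteration (PINVIT) $$x_{i+1}=x_i-T\bigl(Ax_i-\rho(x_i)x_i\bigr)$$ with preconditioner $T$, carried out in finite precision as follows. The residual $r_i=Ax_i-\rho(x_i)x_i$ is evaluated in working precision with unit roundoff $\boldsymbol u_h$, giving $\hat r_i$, where the computed matrix--vector product satisfies $\mathrm{fl}(Ax_i)=(A+\Delta A)x_i$ for some symmetric matrix $\Delta A$ (depending on $x_i$) with $\|\Delta A\|_2\le\epsilon_A\|A\|_2$. The inexact application of the preconditioner $T$ to $\hat r_i$ yields $\hat w_i=T_E\hat r_i$ for a matrix $T_E\in\mathbb R^{n\times n}$ (which may depend on $i$). Finally $\hat x_{i+1}=\mathrm{fl}(x_i-\hat w_i)$ is computed in working precision. Set $\gamma_k^h=\frac{k\boldsymbol u_h}{1-k\boldsymbol u_h}$ for $k\in\{2,n\}$ and $$\epsilon_r=\bigl(\gamma_n^h+\epsilon_A+\gamma_n^h\epsilon_A+(n+1)\boldsymbol u_h\bigr)\frac{1+\boldsymbol u_h}{1-2n\boldsymbol u_h}+\epsilon_A+\boldsymbol u_h.$$ If $\lambda_1<\rho(x_i)<\lambda_2$ and $$\gamma:=\|I-A^{1/2}T_EA^{1/2}\|_2+\gamma_2^h\|T_E\|_2\|A\|_2+\beta(x_i)\bigl(\boldsymbol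 u_h+(1+\gamma_2^h)\epsilon_r\|T_E\|_2\|A\|_2\bigr)<1,$$ where $$\beta(x_i)=\max\left\{\frac{\sqrt{\lambda_1\lambda_n}}{\rho(x_i)-\lambda_1},\ \frac{\sqrt{\lambda_2\lambda_n}}{\lambda_2-\rho(x_i)}\right\},$$ then the computed result $\hat x_{i+1}$ satisfies $$\frac{\rho(\hat x_{i+1})-\lambda_1}{\lambda_2-\rho(\hat x_{i+1})}\le\Bigl(\gamma+(1-\gamma)\frac{\lambda_1}{\lambda_2}\Bigr)^2\,\frac{\rho(x_i)-\lambda_1}{\lambda_2-\rho(x_i)}.$$
   Context: Rounding error model: floating point arithmetic with unit roundoff $\boldsymbol u_h$ follows the standard model: $\mathrm{fl}(a\circ b)=(a\circ b)(1+\delta)$ with $|\delta|\le\boldsymbol u_h$ for $\circ\in\{+,-,\times,/\}$ (no overflow or underflow). $\mathrm{fl}(\cdot)$ denotes the computed value of an expression. The vector $x_i$ and matrix $A$ are the given (exact) data. The quantity $r_i$ is evaluated as follows: compute the vector $\mathrm{fl}(Ax_i)$; compute the inner product of $x_i$ with the vector $\mathrm{fl}(Ax_i)$ in floating point, giving $\mathrm{fl}(x_i^{\top}Ax_i)$; compute $\mathrm{fl}(x_i^{\top}x_i)$; divide the two to obtain $\mathrm{fl}(\rho(x_i))$; scale $x_i$ by $\mathrm{fl}(\rho(x_i))$; and subtract the result from $\mathrm{fl}(Ax_i)$. Each inner product is computed in the usual way, so that $|\mathrm{fl}(x^{\top}y)-x^{\top}y|\le\gamma_n^h\,|x|^{\top}|y|$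 for all floating point vectors $x,y$ of length $n$. The matrix $T_E$ models all errors made in applying the preconditioner (possibly in a lower precision). Standing assumption: $n^{-1}$ is far larger than the unit roundoff; in particular $2n\boldsymbol u_h<1$. $\|\cdot\|_2$ is the Euclidean vector norm / spectral matrix norm, and $A^{1/2}$ is the symmetric positive definite square root of $A$. *)

theory Defs
  imports "HOL-Analysis.Analysis"
begin

definition spd :: "real ^ 'n ^ 'n \<Rightarrow> bool" where
  "spd A \<longleftrightarrow> transpose A = A \<and> (\<forall>v. v \<noteq> 0 \<longrightarrow> 0 < v \<bullet> (A *v v))"

text \<open>The description is proper exactly when \<open>A\<close> is symmetric positive definite; it is only
  meant to be used for such \<open>A\<close>.\<close>

definition spd_sqrt :: "real ^ 'n ^ 'n \<Rightarrow> real ^ 'n ^ 'n" where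
  "spd_sqrt A = (THE S. spd S \<and> S ** S = A)"

text \<open>Operator norm induced by the Euclidean norm of \<open>real ^ 'n\<close>. (The type class \<open>norm\<close> on
  matrices would give the Frobenius norm instead.)\<close>

definition spectral_norm :: "real ^ 'n ^ 'n \<Rightarrow> real" where
  "spectral_norm M = onorm (\<lambda>v. M *v v)"

text \<open>\<open>lam 1, \<dots>, lam n\<close> (with \<open>n = CARD('n)\<close>) are the eigenvalues of \<open>A\<close>, listed with
  algebraic multiplicity: they are the roots of the characteristic polynomial. The values of
  \<open>lam\<close> outside \<open>{1..n}\<close> are irrelevant.\<close>

definition eigenvalues :: "real ^ 'n ^ 'n \<Rightarrow> (nat \<Rightarrow> real) \<Rightarrow> bool" where
  "eigenvalues A lam \<longleftrightarrow> (\<forall>t. det (mat t - A) = (\<Prod>j = 1..CARD('n). t - lam j))"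

definition rayleigh :: "real ^ 'n ^ 'n \<Rightarrow> real ^ 'n \<Rightarrow> real" where
  "rayleigh A v = (v \<bullet> (A *v v)) / (v \<bullet> v)"

definition gam :: "nat \<Rightarrow> real \<Rightarrow> real" where
  "gam k u = real k * u / (1 - real k * u)"

text \<open>Computed values are modelled relationally: \<open>fl u e c\<close> says that \<open>c\<close> is an admissible result
  of a single floating point operation with unit roundoff \<open>u\<close> and exact result \<open>e\<close>.\<close>

definition fl :: "real \<Rightarrow> real \<Rightarrow> real \<Rightarrow> bool" where
  "fl u e c \<longleftrightarrow> (\<exists>\<delta>. \<bar>\<delta>\<bar> \<le> u \<and> c = e * (1 + \<delta>))"

definition fl_vec :: "real \<Rightarrow> real ^ 'n \<Rightarrow> real ^ 'n \<Rightarrow> bool" where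
  "fl_vec u e c \<longleftrightarrow> (\<forall>j. fl u (e $ j) (c $ j))"

text \<open>The order of summation is left open; the value is specified by the standard error bound.\<close>

definition fl_inner :: "real \<Rightarrow> real ^ 'n \<Rightarrow> real ^ 'n \<Rightarrow> real \<Rightarrow> bool" where
  "fl_inner u v w c \<longleftrightarrow> \<bar>c - v \<bullet> w\<bar> \<le> gam CARD('n) u * (\<Sum>j\<in>UNIV. \<bar>v $ j\<bar> * \<bar>w $ j\<bar>)"

definition fl_matvec :: "real \<Rightarrow> real ^ 'n ^ 'n \<Rightarrow> real ^ 'n \<Rightarrow> real ^ 'n \<Rightarrow> bool" where
  "fl_matvec \<epsilon> A v c \<longleftrightarrow>
     (\<exists>E. transpose E = E \<and> spectral_norm E \<le> \<epsilon> * spectral_norm A \<and> c = (A + E) *v v)"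

text \<open>Here \<open>y\<close>, \<open>s\<close>, \<open>t\<close>, \<open>q\<close> and \<open>z\<close> are the computed values of \<open>A x\<close>, \<open>x\<^sup>T A x\<close>, \<open>x\<^sup>T x\<close>,
  the Rayleigh quotient, and the scaled vector \<open>x\<close>, respectively.\<close>

definition fl_residual ::
    "real \<Rightarrow> real \<Rightarrow> real ^ 'n ^ 'n \<Rightarrow> real ^ 'n \<Rightarrow> real ^ 'n \<Rightarrow> bool" where
  "fl_residual u \<epsilon> A x r \<longleftrightarrow>
     (\<exists>y s t q z.
        fl_matvec \<epsilon> A x y \<and>
        fl_inner u x y s \<and>
        fl_inner u x x t \<and>
        fl u (s / t) q \<and>
        fl_vec u (q *\<^sub>R x) z \<and>
        fl_vec u (y - z) r)"

end

theory Submission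
  imports Defs
begin

text \<open>Write \<open>S\<close> for the square root of \<open>A\<close> and \<open>\<rho>\<close> for the Rayleigh quotient of \<open>x\<close>. In exact arithmetic
\<open>S x' - \<rho> S\<^sup>-\<^sup>1 x = (I - S T S) (S x - \<rho> S\<^sup>-\<^sup>1 x)\<close>. Measured in the norm \<open>\<parallel>S \<cdot>\<parallel>\<close>, the new iterate \<open>x'\<close> thus
lies in a ball around \<open>\<rho> A\<^sup>-\<^sup>1 x\<close>, the outcome of an exact step of inverse iteration, whose radius is
\<open>\<parallel>I - S T S\<parallel>\<close> times the distance of \<open>x\<close> from that centre. This is all that the
convergence proof uses, so rounding errors only have to be shown to enlarge the factor to the given
\<open>\<gamma>\<close>.

Rounding errors (\<open>fl_residual_error\<close>, \<open>computed_step_in_ball\<close>) are of two kinds. Those proportional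
to the residual contribute the term with \<open>gam 2 u\<close>. Those proportional to \<open>x\<close> are compared with the
residual by \<open>norm_le_scaled_residual\<close>: the residual of a vector of given length is bounded below in terms
of the distance of \<open>\<rho>\<close> from the eigenvalues \<open>lam 1\<close> and \<open>lam 2\<close>, and this is where \<open>\<beta>\<close> comes from.

For the convergence estimate (\<open>contraction\<close>, \<open>pinvit_contraction\<close>) put \<open>B = A\<^sup>-\<^sup>1\<close>,
\<open>v = S x\<close>, \<open>\<mu> = 1 / \<rho>\<close>, \<open>w = \<mu> S x'\<close>, and let \<open>\<mu>\<^sub>1 > \<mu>\<^sub>2\<close> be the two largest eigenvalues of \<open>B\<close>. The
ball condition reads \<open>\<parallel>w - B v\<parallel> \<le> \<gamma> \<parallel>B v - \<mu> v\<parallel>\<close>. With \<open>N(z)\<^sup>2 = z \<bullet> (\<mu>\<^sub>1 - B) z\<close> and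
\<open>D(z)\<^sup>2 = z \<bullet> (B - \<mu>\<^sub>2) z\<close>, the quantity to be estimated is \<open>(N / D)\<^sup>2\<close> up to a constant factor. Now
\<open>w = (1 - \<gamma>) B v + \<gamma> w\<^sub>1\<close> with a point \<open>w\<^sub>1\<close> of the ball for \<open>\<gamma> = 1\<close>. The first point has
\<open>N(B v) \<le> \<mu>\<^sub>2 N(v)\<close> and \<open>D(B v) \<ge> \<mu>\<^sub>1 D(v)\<close>; the second one satisfies both
\<open>N(w\<^sub>1) / D(w\<^sub>1) \<le> N(v) / D(v)\<close> and \<open>N(w\<^sub>1) \<le> \<mu>\<^sub>1 N(v)\<close>. Because \<open>N\<close> is a seminorm and \<open>D\<close>, the root
of a Lorentzian form, satisfies the reversed triangle inequality on its forward cone, these bounds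
combine to \<open>N(w) / D(w) \<le> (\<gamma> + (1 - \<gamma>) \<mu>\<^sub>2 / \<mu>\<^sub>1) N(v) / D(v)\<close>.

All of this is carried out in an orthonormal eigenbasis of \<open>A\<close>, where the quadratic forms are
weighted sums of squares and most inequalities hold termwise.\<close>

section \<open>The spectral theorem for real symmetric matrices\<close>

lemma inner_symmetric_matrix:
  fixes A :: "real ^ 'n ^ 'n"
  assumes "transpose A = A"
  shows "x \<bullet> (A *v y) = (A *v x) \<bullet> y"
  by (metis assms dot_lmul_matrix vector_transpose_matrix)

text \<open>A maximiser \<open>v\<close> of the quadratic form on the unit sphere of \<open>U\<close> is an eigenvector: with \<open>c\<close> the
maximum, \<open>h w = c * (w \<bullet> w) - w \<bullet> (A *v w)\<close> is nonnegative on \<open>U\<close> and vanishes at \<open>v\<close>, so its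
derivative at \<open>v\<close> in the direction of its own gradient \<open>c *\<^sub>R v - A *v v\<close> must vanish.\<close>

lemma eigenvector_in_invariant_subspace:
  fixes A :: "real ^ 'n ^ 'n"
  assumes sym: "transpose A = A" and U: "subspace U" and nontriv: "U \<noteq> {0}"
    and inv: "\<And>v. v \<in> U \<Longrightarrow> A *v v \<in> U"
  shows "\<exists>v\<in>U. \<exists>c. norm v = 1 \<and> A *v v = c *\<^sub>R v"
proof -
  let ?K = "sphere 0 1 \<inter> U"
  obtain u where "u \<in> U" "u \<noteq> 0"
    using nontriv subspace_0[OF U] by blast
  then have "u /\<^sub>R norm u \<in> ?K"
    using U by (simp add: subspace_scale)
  moreover have "compact ?K"
    by (simp add: closed_subspace[OF U] compact_Int_closed)
  moreover have "continuous_on ?K (\<lambda>v. v \<bullet> (A *v v))"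
    by (intro continuous_intros linear_continuous_on) (simp add: matrix_vector_mul_bounded_linear)
  ultimately obtain v where v: "v \<in> ?K" and vmax: "\<And>w. w \<in> ?K \<Longrightarrow> w \<bullet> (A *v w) \<le> v \<bullet> (A *v v)"
    using continuous_attains_sup[of ?K "\<lambda>v. v \<bullet> (A *v v)"] by blast
  define c where "c = v \<bullet> (A *v v)"
  define h where "h w = c * (w \<bullet> w) - w \<bullet> (A *v w)" for w
  have vv: "v \<bullet> v = 1" and vU: "v \<in> U"
    using v by (auto simp: dot_square_norm)
  have h_nonneg: "h w \<ge> 0" if "w \<in> U" for w
  proof (cases "w = 0")
    case False
    have "(w /\<^sub>R norm w) \<bullet> (A *v (w /\<^sub>R norm w)) \<le> c"
      unfolding c_def using False that U by (intro vmax) (auto simp: subspace_scale)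
    then have "(w \<bullet> (A *v w)) / (w \<bullet> w) \<le> c"
      by (simp add: matrix_vector_mult_scaleR dot_square_norm power2_eq_square divide_inverse mult_ac)
    then show ?thesis
      using False by (simp add: h_def divide_simps mult.commute)
  qed (simp add: h_def)
  define g where "g = c *\<^sub>R v - A *v v"
  have gU: "g \<in> U"
    unfolding g_def using vU U inv by (intro subspace_diff subspace_scale) auto
  have expand: "h (v + t *\<^sub>R g) = 2 * t * (g \<bullet> g) + t\<^sup>2 * h g" for t
  proof -
    have "h (v + t *\<^sub>R g) = h v + 2 * t * (c * (v \<bullet> g) - (A *v v) \<bullet> g) + t\<^sup>2 * h g"
      using inner_symmetric_matrix[OF sym, of v g]
      by (simp add: h_def matrix_vector_right_distrib matrix_vector_mult_scaleR inner_add_left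
          inner_add_right inner_commute power2_eq_square algebra_simps)
    moreover have "h v = 0"
      by (simp add: h_def c_def vv)
    moreover have "c * (v \<bullet> g) - (A *v v) \<bullet> g = g \<bullet> g"
      by (simp add: g_def inner_diff_left)
    ultimately show ?thesis
      by simp
  qed
  have "g \<bullet> g = 0"
  proof (rule ccontr)
    assume "g \<bullet> g \<noteq> 0"
    then have pos: "g \<bullet> g > 0"
      by simp
    \<comment> \<open>a step against \<open>g\<close> so short that the linear term outweighs the quadratic one; the summand
      1 keeps the denominator positive\<close>
    define t where "t = - (g \<bullet> g) / (h g + 1)"
    have hg: "h g \<ge> 0"
      by (rule h_nonneg[OF gU])
    have "0 \<le> 2 * t * (g \<bullet> g) + t\<^sup>2 * h g"
      using h_nonneg[of "v + t *\<^sub>R g"] U vU gU by (simp add: expand subspace_add subspace_scale)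
    also have "\<dots> \<le> 2 * t * (g \<bullet> g) + t\<^sup>2 * (h g + 1)"
      by (simp add: algebra_simps)
    also have "t\<^sup>2 * (h g + 1) = - t * (g \<bullet> g)"
      using hg by (simp add: t_def power2_eq_square)
    finally have "0 \<le> t * (g \<bullet> g)"
      by simp
    moreover have "t < 0"
      using pos hg by (simp add: t_def divide_simps)
    ultimately show False
      using pos by (simp add: zero_le_mult_iff)
  qed
  then have "A *v v = c *\<^sub>R v"
    by (simp add: g_def)
  then show ?thesis
    using v by auto
qed

text \<open>An orthonormal set of eigenvectors of maximal cardinality spans: its orthogonal complement is
invariant under \<open>A\<close>, so a nontrivial complement would contain one more eigenvector.\<close>

lemma orthonormal_eigenbasis:
  fixes A :: "real ^ 'n ^ 'n"
  assumes sym: "transpose A = A"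
  shows "\<exists>B. pairwise orthogonal B \<and> (\<forall>v\<in>B. norm v = 1 \<and> (\<exists>c. A *v v = c *\<^sub>R v)) \<and>
             finite B \<and> card B = CARD('n)"
proof -
  define good where "good B \<longleftrightarrow>
    pairwise orthogonal B \<and> (\<forall>v\<in>B. norm v = 1 \<and> (\<exists>c. A *v v = c *\<^sub>R v))" for B
  have indep: "independent B" if "good B" for B
    using that unfolding good_def by (intro pairwise_orthogonal_independent) auto
  have bound: "finite B \<and> card B \<le> CARD('n)" if "good B" for B
    using independent_bound[OF indep[OF that]] by simp
  have "good {}"
    by (simp add: good_def)
  then obtain B where B: "good B" and Bmax: "\<And>C. good C \<Longrightarrow> card C \<le> card B"
    using bound ex_has_greatest_nat[of good "{}" card "Suc CARD('n)"]
    by (metis le_imp_less_Suc)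
  let ?U = "orthogonal_comp B"
  have "?U = {0}"
  proof (rule ccontr)
    assume "?U \<noteq> {0}"
    moreover have "A *v v \<in> ?U" if "v \<in> ?U" for v
      unfolding orthogonal_comp_def
    proof (safe)
      fix b assume "b \<in> B"
      then obtain c where "A *v b = c *\<^sub>R b"
        using B by (auto simp: good_def)
      then show "orthogonal b (A *v v)"
        using that \<open>b \<in> B\<close>
        by (simp add: orthogonal_def orthogonal_comp_def inner_symmetric_matrix[OF sym])
    qed
    ultimately obtain v c where v: "v \<in> ?U" "norm v = 1" "A *v v = c *\<^sub>R v"
      using eigenvector_in_invariant_subspace[OF sym subspace_orthogonal_comp] by blast
    have orth: "orthogonal b v" "orthogonal v b" if "b \<in> B" for b
      using v(1) that by (auto simp: orthogonal_comp_def orthogonal_commute)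
    have "v \<notin> B"
      using orth(1)[of v] v(2) by (auto simp: orthogonal_self)
    moreover have "good (insert v B)"
      using B v orth unfolding good_def by (auto simp: pairwise_insert)
    ultimately show False
      using Bmax[of "insert v B"] bound[OF B] by simp
  qed
  then have "orthogonal_comp (span B) = {0}"
    using orthogonal_comp_anti_mono[OF span_superset[of B]] subspace_0[OF subspace_orthogonal_comp]
    by blast
  then have "span B = UNIV"
    by (metis orthogonal_comp_null orthogonal_comp_self subspace_span)
  then have "card B = CARD('n)"
    using indep_card_eq_dim_span[OF indep[OF B]] by simp
  then show ?thesis
    using B bound[OF B] unfolding good_def by blast
qed

section \<open>Functional calculus and the square root\<close>

text \<open>The functional calculus: if the columns of the orthogonal matrix \<open>P\<close> are eigenvectors of \<open>A\<close> with
eigenvalues \<open>d\<close>, then \<open>spectral_fun P d\<close> is \<open>A\<close> and \<open>spectral_fun P (\<lambda>i. f (d i))\<close> is \<open>f A\<close>.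
The coordinates of a vector \<open>x\<close> in the eigenbasis are \<open>transpose P *v x\<close>.\<close>

definition spectral_fun :: "real ^ 'n ^ 'n \<Rightarrow> ('n \<Rightarrow> real) \<Rightarrow> real ^ 'n ^ 'n" where
  "spectral_fun P f = P ** (\<chi> i j. if i = j then f i else 0) ** transpose P"

lemma diag_mult_vec:
  fixes x :: "real ^ 'n"
  shows "(\<chi> i j. if i = j then f i else 0) *v x = (\<chi> i. f i * x $ i)"
  by (simp add: vec_eq_iff matrix_vector_mult_def if_distrib[of "\<lambda>a. a * _"] cong: if_cong)

lemma spectral_fun_mult_vec:
  "spectral_fun P f *v x = P *v (\<chi> i. f i * (transpose P *v x) $ i)"
  unfolding spectral_fun_def by (simp add: diag_mult_vec flip: matrix_vector_mul_assoc)

lemma coords_spectral_fun: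
  fixes P :: "real ^ 'n ^ 'n"
  assumes "orthogonal_matrix P"
  shows "transpose P *v (spectral_fun P f *v x) = (\<chi> i. f i * (transpose P *v x) $ i)"
  using assms unfolding spectral_fun_mult_vec orthogonal_matrix_def
  by (simp add: matrix_vector_mul_assoc)

lemma coords_inner:
  fixes P :: "real ^ 'n ^ 'n"
  assumes "orthogonal_matrix P"
  shows "(transpose P *v x) \<bullet> (transpose P *v y) = x \<bullet> y"
  using assms unfolding orthogonal_matrix_def
  by (metis dot_lmul_matrix matrix_vector_mul_assoc matrix_vector_mul_lid vector_transpose_matrix)

lemma inner_spectral_fun:
  fixes P :: "real ^ 'n ^ 'n"
  assumes "orthogonal_matrix P"
  shows "x \<bullet> (spectral_fun P f *v x) = (\<Sum>i\<in>UNIV. f i * ((transpose P *v x) $ i)\<^sup>2)"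
  unfolding coords_inner[OF assms, of x, symmetric] coords_spectral_fun[OF assms]
  by (simp add: inner_vec_def power2_eq_square mult_ac)

lemma norm_spectral_fun:
  fixes P :: "real ^ 'n ^ 'n"
  assumes "orthogonal_matrix P"
  shows "(norm (spectral_fun P f *v x))\<^sup>2 = (\<Sum>i\<in>UNIV. (f i * (transpose P *v x) $ i)\<^sup>2)"
  unfolding dot_square_norm[symmetric] coords_inner[OF assms, of "spectral_fun P f *v x", symmetric]
    coords_spectral_fun[OF assms]
  by (simp add: inner_vec_def power2_eq_square)

lemma spectral_fun_mult:
  fixes P :: "real ^ 'n ^ 'n"
  assumes "orthogonal_matrix P"
  shows "spectral_fun P f ** spectral_fun P g = spectral_fun P (\<lambda>i. f i * g i)"
proof -
  have "(spectral_fun P f ** spectral_fun P g) *v x = spectral_fun P (\<lambda>i. f i * g i) *v x" for x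
    by (simp add: coords_spectral_fun[OF assms] spectral_fun_mult_vec[of P f]
        spectral_fun_mult_vec[of P "\<lambda>i. f i * g i"] mult.assoc del: transpose_matrix_vector flip: matrix_vector_mul_assoc)
  then show ?thesis
    by (simp add: matrix_eq)
qed

lemma spectral_fun_const:
  fixes P :: "real ^ 'n ^ 'n"
  assumes "orthogonal_matrix P"
  shows "spectral_fun P (\<lambda>_. t) = mat t"
proof -
  have "spectral_fun P (\<lambda>_. t) *v x = t *\<^sub>R x" for x
  proof -
    have "(\<chi> i. t * (transpose P *v x) $ i) = t *\<^sub>R (transpose P *v x)"
      by (simp add: vec_eq_iff)
    then show ?thesis
      using assms by (simp add: spectral_fun_mult_vec matrix_vector_mult_scaleR
          matrix_vector_mul_assoc orthogonal_matrix_def del: transpose_matrix_vector)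
  qed
  moreover have "mat t *v x = t *\<^sub>R x" for x :: "real ^ 'n"
    by (simp add: vec_eq_iff matrix_vector_mult_def mat_def if_distrib[of "\<lambda>a. a * _"] cong: if_cong)
  ultimately show ?thesis
    by (simp add: matrix_eq)
qed

lemma spectral_fun_diff:
  "spectral_fun P f - spectral_fun P g = spectral_fun P (\<lambda>i. f i - g i)"
proof -
  have "(\<chi> i. (f i - g i) * y $ i) = (\<chi> i. f i * y $ i) - (\<chi> i. g i * y $ i)" for y :: "real ^ 'a"
    by (simp add: vec_eq_iff left_diff_distrib)
  then show ?thesis
    by (simp add: matrix_eq matrix_vector_mult_diff_rdistrib spectral_fun_mult_vec
        matrix_vector_mult_diff_distrib)
qed

lemma transpose_spectral_fun: "transpose (spectral_fun P f) = spectral_fun P f"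
proof -
  have "transpose (\<chi> i j. if i = j then f i else 0) = (\<chi> i j. if i = j then f i else 0)"
    by (auto simp: transpose_def vec_eq_iff)
  then show ?thesis
    unfolding spectral_fun_def by (simp add: matrix_transpose_mul matrix_mul_assoc)
qed

lemma det_spectral_fun:
  fixes P :: "real ^ 'n ^ 'n"
  assumes "orthogonal_matrix P"
  shows "det (spectral_fun P f) = (\<Prod>i\<in>UNIV. f i)"
proof -
  have "det P * det P = 1"
    using assms det_orthogonal_matrix[of P] by auto
  moreover have "det ((\<chi> i j. if i = j then f i else 0) :: real ^ 'n ^ 'n) = (\<Prod>i\<in>UNIV. f i)"
    by (subst det_diagonal) auto
  ultimately show ?thesis
    by (simp add: spectral_fun_def det_mul mult_ac)
qed

theorem symmetric_matrix_diagonalizable: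
  fixes A :: "real ^ 'n ^ 'n"
  assumes "transpose A = A"
  shows "\<exists>P d. orthogonal_matrix P \<and> A = spectral_fun P d"
proof -
  obtain B where B: "pairwise orthogonal B" "finite B" "card B = CARD('n)"
    and eig: "\<forall>v\<in>B. norm v = 1 \<and> (\<exists>c. A *v v = c *\<^sub>R v)"
    using orthonormal_eigenbasis[OF assms] by blast
  obtain b :: "'n \<Rightarrow> real ^ 'n" where b: "bij_betw b UNIV B"
    using B finite_same_card_bij[of "UNIV :: 'n set" B] by auto
  then have bB: "b k \<in> B" for k
    by (auto simp: bij_betw_def)
  then have "\<forall>k. \<exists>c. A *v b k = c *\<^sub>R b k"
    using eig by blast
  then obtain d where d: "\<And>k. A *v b k = d k *\<^sub>R b k"
    by metis
  define P :: "real ^ 'n ^ 'n" where "P = (\<chi> i k. b k $ i)"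
  have col: "column k P = b k" for k
    by (simp add: column_def P_def vec_eq_iff)
  have "orthogonal (b i) (b j)" if "i \<noteq> j" for i j
    using that b bB[of i] bB[of j] B(1) by (auto simp: pairwise_def bij_betw_def dest: injD)
  then have P: "orthogonal_matrix P"
    using eig bB by (simp add: orthogonal_matrix_orthonormal_columns col)
  have "A ** P = P ** (\<chi> i j. if i = j then d i else 0)"
  proof -
    have "(A ** P) $ i $ k = (P ** (\<chi> i j. if i = j then d i else 0)) $ i $ k" for i k
    proof -
      have "(A ** P) $ i $ k = (A *v b k) $ i"
        by (simp add: matrix_matrix_mult_def matrix_vector_mult_def P_def)
      also have "\<dots> = d k * b k $ i"
        by (simp add: d)
      also have "\<dots> = (P ** (\<chi> i j. if i = j then d i else 0)) $ i $ k"
        by (simp add: matrix_matrix_mult_def P_def if_distrib[of "\<lambda>a. _ * a"] cong: if_cong)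
      finally show ?thesis .
    qed
    then show ?thesis
      by (simp add: vec_eq_iff)
  qed
  then have "A ** (P ** transpose P) = spectral_fun P d"
    by (simp add: spectral_fun_def matrix_mul_assoc)
  then have "A = spectral_fun P d"
    using P by (simp add: orthogonal_matrix_def)
  then show ?thesis
    using P by blast
qed

lemma spd_spectral_fun_iff:
  fixes P :: "real ^ 'n ^ 'n"
  assumes P: "orthogonal_matrix P"
  shows "spd (spectral_fun P f) \<longleftrightarrow> (\<forall>i. 0 < f i)"
proof
  assume spd: "spd (spectral_fun P f)"
  show "\<forall>i. 0 < f i"
  proof
    fix i
    have c: "transpose P *v (P *v axis i 1) = axis i 1"
      using P by (simp add: matrix_vector_mul_assoc orthogonal_matrix_def)
    then have "P *v axis i 1 \<noteq> 0"
      by (metis axis_eq_0_iff matrix_vector_mult_0_right zero_neq_one)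
    then have "0 < (\<Sum>j\<in>UNIV. f j * (axis i 1 $ j :: real)\<^sup>2)"
      using spd inner_spectral_fun[OF P, of "P *v axis i 1" f]
      unfolding spd_def c by metis
    also have "\<dots> = f i"
      by (simp add: axis_def if_distrib[of "\<lambda>a. a\<^sup>2"] if_distrib[of "\<lambda>a. _ * a"] cong: if_cong)
    finally show "0 < f i" .
  qed
next
  assume pos: "\<forall>i. 0 < f i"
  show "spd (spectral_fun P f)"
    unfolding spd_def
  proof (intro conjI allI impI transpose_spectral_fun)
    fix v :: "real ^ 'n" assume "v \<noteq> 0"
    then have "transpose P *v v \<noteq> 0"
      using coords_inner[OF P, of v v] by auto
    then obtain i where "(transpose P *v v) $ i \<noteq> 0"
      by (auto simp: vec_eq_iff)
    then show "0 < v \<bullet> (spectral_fun P f *v v)"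
      unfolding inner_spectral_fun[OF P] using pos
      by (intro sum_pos2[of _ i]) (auto simp: zero_le_mult_iff less_imp_le)
  qed
qed

text \<open>Both matrices agree on every eigenvector \<open>p\<close> of \<open>R\<close>. If \<open>R *v p = s *\<^sub>R p\<close>, then
\<open>(S + s) (S - s) p = (S ** S) p - s\<^sup>2 p = 0\<close>, and \<open>S + s\<close> is injective because \<open>S\<close> is positive definite
and \<open>s > 0\<close>; hence \<open>S *v p = s *\<^sub>R p\<close>.\<close>

lemma spd_sqrt_unique:
  fixes S R :: "real ^ 'n ^ 'n"
  assumes S: "spd S" and R: "spd R" and eq: "S ** S = R ** R"
  shows "S = R"
proof -
  obtain P s where P: "orthogonal_matrix P" and s: "R = spectral_fun P s"
    using symmetric_matrix_diagonalizable R unfolding spd_def by blast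
  have pos: "0 < s i" for i
    using R P s spd_spectral_fun_iff by blast
  have "S *v (P *v axis k 1) = R *v (P *v axis k 1)" for k
  proof -
    let ?p = "P *v axis k 1"
    have "transpose P *v ?p = axis k 1"
      using P by (simp add: matrix_vector_mul_assoc orthogonal_matrix_def)
    moreover have "(\<chi> i. s i * axis k 1 $ i) = s k *\<^sub>R axis k 1"
      by (simp add: vec_eq_iff axis_def)
    ultimately have Rp: "R *v ?p = s k *\<^sub>R ?p"
      by (simp add: s spectral_fun_mult_vec matrix_vector_mult_scaleR)
    define z where "z = S *v ?p - s k *\<^sub>R ?p"
    have "S *v (S *v ?p) = s k *\<^sub>R (s k *\<^sub>R ?p)"
      by (metis Rp eq matrix_vector_mul_assoc matrix_vector_mult_scaleR)
    then have "S *v z = - s k *\<^sub>R z"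
      by (simp add: z_def matrix_vector_mult_diff_distrib matrix_vector_mult_scaleR algebra_simps)
    then have "z \<bullet> (S *v z) \<le> 0"
      using pos[of k] by (simp add: less_imp_le)
    then have "z = 0"
      using S unfolding spd_def by (meson not_less)
    then show ?thesis
      by (simp add: z_def Rp)
  qed
  then have "(S ** P) *v axis k 1 = (R ** P) *v axis k 1" for k
    by (simp add: matrix_vector_mul_assoc)
  then have "S ** P = R ** P"
    by (simp add: vec_eq_iff matrix_vector_mult_basis column_def)
  then have "S ** (P ** transpose P) = R ** (P ** transpose P)"
    by (simp add: matrix_mul_assoc)
  then show ?thesis
    using P by (simp add: orthogonal_matrix_def)
qed

lemma spd_sqrt_spectral_fun:
  fixes P :: "real ^ 'n ^ 'n"
  assumes P: "orthogonal_matrix P" and pos: "\<And>i. 0 < d i"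
  shows "spd_sqrt (spectral_fun P d) = spectral_fun P (\<lambda>i. sqrt (d i))"
proof -
  let ?S = "spectral_fun P (\<lambda>i. sqrt (d i))"
  have "spd ?S"
    using pos by (simp add: spd_spectral_fun_iff[OF P])
  moreover have "?S ** ?S = spectral_fun P d"
    using pos by (simp add: spectral_fun_mult[OF P] less_imp_le)
  ultimately show ?thesis
    unfolding spd_sqrt_def by (intro the_equality) (auto intro: spd_sqrt_unique)
qed

section \<open>Eigenvalues and the characteristic polynomial\<close>

text \<open>Two factorisations of the same polynomial have the same roots; that the root \<open>lam 1\<close> occurs only
once among the \<open>d i\<close> follows by cancelling one factor \<open>t - lam 1\<close> and evaluating the rest at
\<open>lam 1\<close>.\<close>

lemma lowest_root_simple:
  fixes d :: "'n::finite \<Rightarrow> real" and lam :: "nat \<Rightarrow> real"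
  assumes eq: "\<And>t. (\<Prod>i\<in>UNIV. t - d i) = (\<Prod>j = 1..CARD('n). t - lam j)"
    and n: "2 \<le> CARD('n)" and gap: "lam 1 < lam 2"
    and mono: "\<And>j. 2 \<le> j \<Longrightarrow> j < CARD('n) \<Longrightarrow> lam j \<le> lam (Suc j)"
  obtains i where "d i = lam 1" and "\<And>j. j \<noteq> i \<Longrightarrow> lam 2 \<le> d j" and "\<And>j. d j \<le> lam CARD('n)"
proof -
  have lam_mono: "lam j \<le> lam k" if "2 \<le> j" "j \<le> k" "k \<le> CARD('n)" for j k
    using that(2,3)
  proof (induction k rule: dec_induct)
    case (step k)
    then show ?case
      using mono[of k] that(1) by linarith
  qed simp
  have mem: "\<exists>k\<in>{1..CARD('n)}. d j = lam k" for j
  proof -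
    have "(\<Prod>i\<in>UNIV. d j - d i) = 0"
      by (rule prod_zero) auto
    then show ?thesis
      unfolding eq by auto
  qed
  have "(\<Prod>j = 1..CARD('n). lam 1 - lam j) = 0"
    using n by (intro prod_zero) auto
  then obtain i where i: "d i = lam 1"
    unfolding eq[symmetric] by auto
  let ?p = "\<Prod>j\<in>UNIV - {i}. [:- d j, 1:]" and ?q = "\<Prod>j = 2..CARD('n). [:- lam j, 1:]"
  have "[:- lam 1, 1:] * ?p = [:- lam 1, 1:] * ?q"
  proof -
    have "[:- lam 1, 1:] * ?p = (\<Prod>j\<in>UNIV. [:- d j, 1:])"
      by (simp add: i prod.remove[of UNIV i])
    also have "\<dots> = (\<Prod>j = 1..CARD('n). [:- lam j, 1:])"
      unfolding poly_eq_poly_eq_iff[symmetric] using eq by (auto simp: poly_prod fun_eq_iff)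
    also have "\<dots> = [:- lam 1, 1:] * ?q"
      using n by (subst prod.atLeast_Suc_atMost) (auto simp: numeral_2_eq_2)
    finally show ?thesis .
  qed
  moreover have "[:- lam 1, 1:] \<noteq> 0"
    by simp
  ultimately have "?p = ?q"
    using mult_left_cancel by blast
  then have "poly ?p (lam 1) = poly ?q (lam 1)"
    by simp
  have "poly ?q (lam 1) \<noteq> 0"
    using lam_mono[of 2] gap by (force simp: poly_prod)
  have simple: "d j \<noteq> lam 1" if "j \<noteq> i" for j
  proof
    assume "d j = lam 1"
    then have "poly ?p (lam 1) = 0"
      using that unfolding poly_prod by (intro prod_zero bexI[of _ j]) auto
    with \<open>poly ?p (lam 1) = poly ?q (lam 1)\<close> \<open>poly ?q (lam 1) \<noteq> 0\<close> show False
      by simp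
  qed
  show thesis
  proof (rule that[OF i])
    fix j assume "j \<noteq> i"
    moreover obtain k where k: "k \<in> {1..CARD('n)}" "d j = lam k"
      using mem by blast
    ultimately show "lam 2 \<le> d j"
      using simple[of j] by (cases "k = 1") (use k lam_mono[of 2 k] in auto)
  next
    fix j
    obtain k where "k \<in> {1..CARD('n)}" "d j = lam k"
      using mem by blast
    then show "d j \<le> lam CARD('n)"
      using lam_mono[of k "CARD('n)"] lam_mono[of 2 "CARD('n)"] gap n
      by (cases "k = 1") auto
  qed
qed

lemma eigenvalues_diagonalization:
  fixes A :: "real ^ 'n ^ 'n" and lam :: "nat \<Rightarrow> real"
  assumes "transpose A = A" and eig: "eigenvalues A lam"
    and n: "2 \<le> CARD('n)" and gap: "lam 1 < lam 2"
    and mono: "\<And>j. 2 \<le> j \<Longrightarrow> j < CARD('n) \<Longrightarrow> lam j \<le> lam (Suc j)"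
  obtains P d i where "orthogonal_matrix P" and "A = spectral_fun P d"
    and "d i = lam 1" and "\<And>j. j \<noteq> i \<Longrightarrow> lam 2 \<le> d j" and "\<And>j. d j \<le> lam CARD('n)"
proof -
  obtain P d where P: "orthogonal_matrix P" and A: "A = spectral_fun P d"
    using symmetric_matrix_diagonalizable[OF assms(1)] by blast
  have "(\<Prod>i\<in>UNIV. t - d i) = (\<Prod>j = 1..CARD('n). t - lam j)" for t
  proof -
    have "(\<Prod>i\<in>UNIV. t - d i) = det (mat t - A)"
      by (simp add: A det_spectral_fun[OF P] spectral_fun_diff flip: spectral_fun_const[OF P])
    then show ?thesis
      using eig by (simp add: eigenvalues_def)
  qed
  then obtain i where "d i = lam 1" "\<And>j. j \<noteq> i \<Longrightarrow> lam 2 \<le> d j" "\<And>j. d j \<le> lam CARD('n)"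
    by (rule lowest_root_simple[OF _ n gap mono]) auto
  then show thesis
    using P A that by blast
qed

section \<open>Diagonal quadratic forms\<close>

definition dform :: "('n \<Rightarrow> real) \<Rightarrow> real ^ 'n \<Rightarrow> real" where
  "dform c v = (\<Sum>j\<in>UNIV. c j * (v $ j)\<^sup>2)"

lemma dform_nonneg: "(\<And>j. 0 \<le> c j) \<Longrightarrow> 0 \<le> dform c v"
  by (simp add: dform_def sum_nonneg)

lemma dform_scaleR: "dform c (a *\<^sub>R v) = a\<^sup>2 * dform c v"
  by (simp add: dform_def sum_distrib_left power_mult_distrib mult_ac)

lemma dform_combination: "dform (\<lambda>j. a * c j + b * e j) v = a * dform c v + b * dform e v"
  by (simp add: dform_def sum_distrib_left sum.distrib algebra_simps)

lemma dform_shift: "dform (\<lambda>j. c j - a) v = dform c v - a * (norm v)\<^sup>2"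
  by (simp add: dform_def norm_vec_def L2_set_def sum_nonneg sum_subtractf sum_distrib_left algebra_simps)

lemma sqrt_dform_scaleR: "0 \<le> a \<Longrightarrow> sqrt (dform c (a *\<^sub>R v)) = a * sqrt (dform c v)"
  by (simp add: dform_scaleR real_sqrt_mult)

lemma dform_triangle:
  assumes "\<And>j. 0 \<le> c j"
  shows "sqrt (dform c (v + w)) \<le> sqrt (dform c v) + sqrt (dform c w)"
proof -
  have "sqrt (dform c z) = norm (\<chi> j. sqrt (c j) * z $ j)" for z
    using assms by (simp add: dform_def norm_vec_def L2_set_def power_mult_distrib)
  moreover have "(\<chi> j. sqrt (c j) * (v + w) $ j)
      = (\<chi> j. sqrt (c j) * v $ j) + (\<chi> j. sqrt (c j) * w $ j)"
    by (simp add: vec_eq_iff algebra_simps)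
  ultimately show ?thesis
    by (metis norm_triangle_ineq)
qed

text \<open>A form with at most one positive coefficient is Lorentzian. On the forward light cone its square
root is superadditive, by the reversed Cauchy-Schwarz inequality
\<open>(\<alpha>\<^sup>2 - p\<^sup>2) (\<beta>\<^sup>2 - q\<^sup>2) \<le> (\<alpha> \<beta> - p q)\<^sup>2\<close>, which is \<open>(\<alpha> q - \<beta> p)\<^sup>2 \<ge> 0\<close>.\<close>

lemma dform_reverse_triangle:
  fixes c :: "'n::finite \<Rightarrow> real"
  assumes neg: "\<And>j. j \<noteq> i \<Longrightarrow> c j \<le> 0"
    and forward: "0 \<le> v $ i" "0 \<le> w $ i" and "0 \<le> dform c v" "0 \<le> dform c w" and "0 \<le> c i"
  shows "sqrt (dform c v) + sqrt (dform c w) \<le> sqrt (dform c (v + w))"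
proof -
  define space where "space z = (\<chi> j. if j = i then 0 else sqrt (- c j) * z $ j)" for z :: "real ^ 'n"
  define time where "time z = sqrt (c i) * z $ i" for z :: "real ^ 'n"
  have split: "dform c z = (time z)\<^sup>2 - (norm (space z))\<^sup>2" for z
  proof -
    have "(norm (space z))\<^sup>2 = (\<Sum>j\<in>UNIV. if j = i then 0 else - c j * (z $ j)\<^sup>2)"
      using neg by (auto simp: norm_vec_def L2_set_def sum_nonneg space_def power_mult_distrib intro!: sum.cong)
    also have "\<dots> = - (\<Sum>j\<in>UNIV - {i}. c j * (z $ j)\<^sup>2)"
      by (simp add: sum.remove[of UNIV i] sum_negf cong: sum.cong_simp)
    finally show ?thesis
      using \<open>0 \<le> c i\<close> by (simp add: dform_def sum.remove[of UNIV i] time_def power_mult_distrib)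
  qed
  have tpos: "0 \<le> time v" "0 \<le> time w"
    using forward \<open>0 \<le> c i\<close> by (simp_all add: time_def)
  have add: "time (v + w) = time v + time w" "space (v + w) = space v + space w"
    by (simp_all add: time_def space_def vec_eq_iff algebra_simps)
  define p where "p = norm (space v)"
  define q where "q = norm (space w)"
  have pq: "p \<le> time v" "q \<le> time w" "0 \<le> p" "0 \<le> q"
    using assms(4,5) tpos by (auto simp: split p_def q_def intro!: power2_le_imp_le[of "norm _"])
  have "sqrt (dform c v) * sqrt (dform c w) \<le> time v * time w - p * q"
  proof -
    have "sqrt (dform c v) * sqrt (dform c w) = sqrt (((time v)\<^sup>2 - p\<^sup>2) * ((time w)\<^sup>2 - q\<^sup>2))"
      by (simp add: split p_def q_def real_sqrt_mult)
    also have "\<dots> \<le> sqrt ((time v * time w - p * q)\<^sup>2)"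
    proof (rule real_sqrt_le_mono)
      have "0 \<le> (time v * q - time w * p)\<^sup>2"
        by simp
      then show "((time v)\<^sup>2 - p\<^sup>2) * ((time w)\<^sup>2 - q\<^sup>2) \<le> (time v * time w - p * q)\<^sup>2"
        by (simp add: power2_eq_square algebra_simps)
    qed
    also have "\<dots> = time v * time w - p * q"
      using mult_mono[OF pq(1,2)] pq tpos by simp
    finally show ?thesis .
  qed
  moreover have "space v \<bullet> space w \<le> p * q"
    using norm_cauchy_schwarz by (simp add: p_def q_def)
  moreover have "dform c (v + w)
      = dform c v + dform c w + 2 * (time v * time w - space v \<bullet> space w)"
    using dot_norm[of "space v" "space w"]
    by (simp add: split add power2_eq_square field_simps)
  ultimately have "(sqrt (dform c v) + sqrt (dform c w))\<^sup>2 \<le> dform c (v + w)"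
    using assms(4,5) by (simp add: power2_sum)
  then show ?thesis
    by (rule real_le_rsqrt)
qed

section \<open>Inverse iteration inside a ball, in eigencoordinates\<close>

text \<open>The diagonal matrix \<open>B\<close> with entries \<open>m\<close> has a simple largest eigenvalue \<open>m i\<close>, the others
being at most \<open>\<mu>\<^sub>2\<close>, and the Rayleigh quotient \<open>\<mu>\<close> of \<open>v\<close> lies in between. For eigenvalues
\<open>m j = 1 / d j\<close> one step of PINVIT becomes one inexact step of the power method with \<open>B\<close>.\<close>

locale diagonal_iteration =
  fixes m :: "'n::finite \<Rightarrow> real" and i :: 'n and \<mu>\<^sub>2 \<mu> :: real and v :: "real ^ 'n"
  assumes m_pos: "\<And>j. 0 < m j" and m_le: "\<And>j. j \<noteq> i \<Longrightarrow> m j \<le> \<mu>\<^sub>2"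
    and \<mu>: "0 < \<mu>\<^sub>2" "\<mu>\<^sub>2 < \<mu>" "\<mu> < m i"
    and rq: "dform m v = \<mu> * (norm v)\<^sup>2"
    and forward: "0 < v $ i"
begin

definition Bv :: "real ^ 'n" where "Bv = (\<chi> j. m j * v $ j)"
definition res :: "real ^ 'n" where "res = Bv - \<mu> *\<^sub>R v"

text \<open>The ratio \<open>(N z / D z)\<^sup>2\<close> is \<open>(m i - \<nu>) / (\<nu> - \<mu>\<^sub>2)\<close> for \<open>\<nu>\<close> the Rayleigh quotient of \<open>z\<close>, so it
measures how far \<open>z\<close> is from the leading eigenvector. \<open>N\<close> is a seminorm, whereas \<open>D\<close> is the square
root of a Lorentzian form; this makes \<open>N\<close> subadditive and \<open>D\<close> superadditive.\<close>

abbreviation N :: "real ^ 'n \<Rightarrow> real" where "N z \<equiv> sqrt (dform (\<lambda>j. m i - m j) z)"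
abbreviation D :: "real ^ 'n \<Rightarrow> real" where "D z \<equiv> sqrt (dform (\<lambda>j. m j - \<mu>\<^sub>2) z)"

lemma m_le_top: "m j \<le> m i"
  using m_le[of j] \<mu> by (cases "j = i") auto

lemma norm_sq_eq: "(norm z)\<^sup>2 = (\<Sum>j\<in>UNIV. (z $ j)\<^sup>2)" for z :: "real ^ 'n"
  by (simp add: norm_vec_def L2_set_def sum_nonneg)

lemma rq_zero: "(\<Sum>j\<in>UNIV. (m j - \<mu>) * (v $ j)\<^sup>2) = 0"
  using dform_shift[of m \<mu> v] rq by (simp add: dform_def)

lemma Bv_nth: "Bv $ j = m j * v $ j"
  by (simp add: Bv_def)

lemma res_nth: "res $ j = (m j - \<mu>) * v $ j"
  by (simp add: res_def Bv_def algebra_simps)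

text \<open>Since \<open>v\<close> has Rayleigh quotient \<open>\<mu>\<close>, the form with coefficients \<open>m j - \<mu>\<close> vanishes at \<open>v\<close>.
Adding a multiple of it replaces \<open>(m j - \<mu>)\<^sup>2\<close> by \<open>(m j - \<mu>) * (m j - c)\<close> for any constant \<open>c\<close>. Here
\<open>c = m i\<close> is the right choice, for the bound on the leading component below it is \<open>c = 0\<close>.\<close>

lemma norm_res_le_deviation: "(norm res)\<^sup>2 \<le> (\<Sum>j\<in>UNIV. ((m i - m j) * v $ j)\<^sup>2)"
proof -
  have "(norm res)\<^sup>2 = (\<Sum>j\<in>UNIV. (m j - \<mu>)\<^sup>2 * (v $ j)\<^sup>2)
      + (\<mu> - m i) * (\<Sum>j\<in>UNIV. (m j - \<mu>) * (v $ j)\<^sup>2)"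
    by (simp add: norm_sq_eq res_nth power_mult_distrib rq_zero)
  also have "\<dots> = (\<Sum>j\<in>UNIV. (m j - \<mu>) * (m j - m i) * (v $ j)\<^sup>2)"
    by (simp add: sum_distrib_left power2_eq_square algebra_simps flip: sum.distrib)
  also have "\<dots> \<le> (\<Sum>j\<in>UNIV. ((m i - m j) * v $ j)\<^sup>2)"
  proof (rule sum_mono)
    fix j
    have "0 \<le> (m i - m j) * (m i - \<mu>)"
      using m_le_top[of j] \<mu> by simp
    then have "(m j - \<mu>) * (m j - m i) \<le> (m i - m j)\<^sup>2"
      by (simp add: power2_eq_square algebra_simps)
    then show "(m j - \<mu>) * (m j - m i) * (v $ j)\<^sup>2 \<le> ((m i - m j) * v $ j)\<^sup>2"
      by (simp add: power_mult_distrib mult_right_mono)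
  qed
  finally show ?thesis .
qed

lemma norm_res_le_leading: "norm res \<le> m i * v $ i"
proof (rule power2_le_imp_le)
  have "(norm res)\<^sup>2 = (\<Sum>j\<in>UNIV. (m j - \<mu>)\<^sup>2 * (v $ j)\<^sup>2)
      + \<mu> * (\<Sum>j\<in>UNIV. (m j - \<mu>) * (v $ j)\<^sup>2)"
    by (simp add: norm_sq_eq res_nth power_mult_distrib rq_zero)
  also have "\<dots> = (\<Sum>j\<in>UNIV. (m j - \<mu>) * m j * (v $ j)\<^sup>2)"
    by (simp add: sum_distrib_left power2_eq_square algebra_simps flip: sum.distrib)
  also have "\<dots> = (m i - \<mu>) * m i * (v $ i)\<^sup>2 + (\<Sum>j\<in>UNIV - {i}. (m j - \<mu>) * m j * (v $ j)\<^sup>2)"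
    by (simp add: sum.remove[of UNIV i])
  also have "(\<Sum>j\<in>UNIV - {i}. (m j - \<mu>) * m j * (v $ j)\<^sup>2) \<le> 0"
  proof (rule sum_nonpos)
    fix j assume "j \<in> UNIV - {i}"
    then have "(m j - \<mu>) * m j \<le> 0"
      using m_le[of j] m_pos[of j] \<mu> by (simp add: mult_nonpos_nonneg)
    then show "(m j - \<mu>) * m j * (v $ j)\<^sup>2 \<le> 0"
      by (simp add: mult_nonpos_nonneg)
  qed
  also have "(m i - \<mu>) * m i * (v $ i)\<^sup>2 + 0 \<le> m i * m i * (v $ i)\<^sup>2"
    using \<mu> m_pos[of i] by (simp add: mult_right_mono)
  also have "\<dots> = (m i * v $ i)\<^sup>2"
    by (simp add: power2_eq_square)
  finally show "(norm res)\<^sup>2 \<le> (m i * v $ i)\<^sup>2"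
    by simp
  show "0 \<le> m i * v $ i"
    using forward m_pos[of i] by simp
qed

context
  fixes h :: "real ^ 'n"
  assumes h: "norm h \<le> norm res"
begin

lemma h_sq: "(norm h)\<^sup>2 \<le> (norm res)\<^sup>2"
  using h by (simp add: power_mono)

text \<open>The ball of radius \<open>norm res\<close> around \<open>Bv\<close>, with points \<open>Bv + h\<close>, is the case \<open>\<gamma> = 1\<close> of the
contraction estimate. It stays inside the forward cone.\<close>

lemma forward_ball: "0 \<le> (Bv + h) $ i"
  using component_le_norm_cart[of h i] h norm_res_le_leading by (simp add: Bv_def)

text \<open>No nonzero point of the ball has a smaller Rayleigh quotient than \<open>v\<close>. Writing \<open>Bv + h = \<mu> *\<^sub>R v + g\<close> with
\<open>g = res + h\<close>, the form with coefficients \<open>m j - \<mu>\<close> at this point equals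
\<open>\<mu> * ((norm res)\<^sup>2 - (norm h)\<^sup>2) + dform m g\<close>, and both summands are nonnegative.\<close>

lemma rayleigh_ball: "\<mu> * (norm (Bv + h))\<^sup>2 \<le> dform m (Bv + h)"
proof -
  have "dform (\<lambda>j. m j - \<mu>) (Bv + h)
      = (\<Sum>j\<in>UNIV. \<mu>\<^sup>2 * ((m j - \<mu>) * (v $ j)\<^sup>2) + \<mu> * ((res $ j)\<^sup>2 - (h $ j)\<^sup>2)
          + m j * (res $ j + h $ j)\<^sup>2)"
    unfolding dform_def
    by (rule sum.cong) (auto simp: Bv_def res_nth power2_eq_square algebra_simps)
  also have "\<dots> = \<mu>\<^sup>2 * (\<Sum>j\<in>UNIV. (m j - \<mu>) * (v $ j)\<^sup>2)
      + \<mu> * ((\<Sum>j\<in>UNIV. (res $ j)\<^sup>2) - (\<Sum>j\<in>UNIV. (h $ j)\<^sup>2))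
      + (\<Sum>j\<in>UNIV. m j * (res $ j + h $ j)\<^sup>2)"
    by (simp only: sum.distrib sum_subtractf flip: sum_distrib_left)
  also have "\<dots> = \<mu> * ((norm res)\<^sup>2 - (norm h)\<^sup>2) + (\<Sum>j\<in>UNIV. m j * (res $ j + h $ j)\<^sup>2)"
    by (simp only: rq_zero norm_sq_eq)
  also have "\<dots> \<ge> 0"
    using h_sq \<mu> m_pos by (intro add_nonneg_nonneg sum_nonneg mult_nonneg_nonneg) (auto intro: less_imp_le)
  finally show ?thesis
    by (simp add: dform_shift)
qed

text \<open>With \<open>c j = (m i - m j) * v $ j - h $ j\<close> one has \<open>(Bv + h) $ j = m i * v $ j - c j\<close>; expanding the square and
bounding \<open>(m i - m j) * (c j)\<^sup>2\<close> by \<open>m i * (c j)\<^sup>2\<close> leaves an excess over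
\<open>(m i * N v)\<^sup>2\<close> of \<open>m i * ((norm h)\<^sup>2 - (\<Sum>j. ((m i - m j) * v $ j)\<^sup>2))\<close>, which is not positive because
the sum is at least \<open>(norm res)\<^sup>2\<close>.\<close>

lemma N_ball: "N (Bv + h) \<le> m i * N v"
proof -
  have "dform (\<lambda>j. m i - m j) (Bv + h)
     \<le> (\<Sum>j\<in>UNIV. (m i)\<^sup>2 * ((m i - m j) * (v $ j)\<^sup>2) + m i * ((h $ j)\<^sup>2 - ((m i - m j) * v $ j)\<^sup>2))"
    unfolding dform_def
  proof (rule sum_mono)
    fix j
    have "0 \<le> m j * ((m i - m j) * v $ j - h $ j)\<^sup>2"
      using m_pos[of j] by (simp add: less_imp_le)
    then show "(m i - m j) * ((Bv + h) $ j)\<^sup>2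
       \<le> (m i)\<^sup>2 * ((m i - m j) * (v $ j)\<^sup>2) + m i * ((h $ j)\<^sup>2 - ((m i - m j) * v $ j)\<^sup>2)"
      by (simp add: Bv_def power2_eq_square algebra_simps)
  qed
  also have "\<dots> = (m i)\<^sup>2 * (\<Sum>j\<in>UNIV. (m i - m j) * (v $ j)\<^sup>2)
      + m i * ((\<Sum>j\<in>UNIV. (h $ j)\<^sup>2) - (\<Sum>j\<in>UNIV. ((m i - m j) * v $ j)\<^sup>2))"
    by (simp only: sum.distrib sum_subtractf flip: sum_distrib_left)
  also have "\<dots> \<le> (m i)\<^sup>2 * (\<Sum>j\<in>UNIV. (m i - m j) * (v $ j)\<^sup>2)"
    using norm_res_le_deviation h_sq m_pos[of i] norm_sq_eq[of h]
    by (simp add: mult_nonneg_nonpos)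
  finally have "dform (\<lambda>j. m i - m j) (Bv + h) \<le> (m i)\<^sup>2 * dform (\<lambda>j. m i - m j) v"
    by (simp add: dform_def)
  then have "N (Bv + h) \<le> sqrt ((m i)\<^sup>2 * dform (\<lambda>j. m i - m j) v)"
    by (rule real_sqrt_le_mono)
  then show ?thesis
    using m_pos[of i] by (simp add: real_sqrt_mult)
qed

end

lemma N_image: "N Bv \<le> \<mu>\<^sub>2 * N v"
proof -
  have "dform (\<lambda>j. m i - m j) Bv \<le> \<mu>\<^sub>2\<^sup>2 * dform (\<lambda>j. m i - m j) v"
    unfolding dform_def sum_distrib_left
  proof (rule sum_mono)
    fix j
    show "(m i - m j) * (Bv $ j)\<^sup>2 \<le> \<mu>\<^sub>2\<^sup>2 * ((m i - m j) * (v $ j)\<^sup>2)"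
    proof (cases "j = i")
      case False
      then have "(m j)\<^sup>2 \<le> \<mu>\<^sub>2\<^sup>2"
        using m_le m_pos[of j] by (simp add: power_mono)
      then have "(m j)\<^sup>2 * ((m i - m j) * (v $ j)\<^sup>2) \<le> \<mu>\<^sub>2\<^sup>2 * ((m i - m j) * (v $ j)\<^sup>2)"
        using m_le_top[of j] by (intro mult_right_mono) auto
      then show ?thesis
        by (simp add: Bv_def power_mult_distrib mult_ac)
    qed simp
  qed
  then have "N Bv \<le> sqrt (\<mu>\<^sub>2\<^sup>2 * dform (\<lambda>j. m i - m j) v)"
    by (rule real_sqrt_le_mono)
  then show ?thesis
    using \<mu> by (simp add: real_sqrt_mult)
qed

lemma D_image: "m i * D v \<le> D Bv"
proof -
  have "(m i)\<^sup>2 * dform (\<lambda>j. m j - \<mu>\<^sub>2) v \<le> dform (\<lambda>j. m j - \<mu>\<^sub>2) Bv"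
    unfolding dform_def sum_distrib_left
  proof (rule sum_mono)
    fix j
    show "(m i)\<^sup>2 * ((m j - \<mu>\<^sub>2) * (v $ j)\<^sup>2) \<le> (m j - \<mu>\<^sub>2) * (Bv $ j)\<^sup>2"
    proof (cases "j = i")
      case False
      have "(m j)\<^sup>2 \<le> (m i)\<^sup>2"
        using m_le_top[of j] m_pos[of j] by (simp add: power_mono)
      then have "(m i)\<^sup>2 * ((m j - \<mu>\<^sub>2) * (v $ j)\<^sup>2) \<le> (m j)\<^sup>2 * ((m j - \<mu>\<^sub>2) * (v $ j)\<^sup>2)"
        using m_le[OF False] by (intro mult_right_mono_neg) (auto simp: mult_nonpos_nonneg)
      then show ?thesis
        by (simp add: Bv_def power_mult_distrib mult_ac)
    qed (simp add: Bv_def power_mult_distrib mult_ac)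
  qed
  then have "sqrt ((m i)\<^sup>2 * dform (\<lambda>j. m j - \<mu>\<^sub>2) v) \<le> D Bv"
    by (rule real_sqrt_le_mono)
  then show ?thesis
    using m_pos[of i] by (simp add: real_sqrt_mult)
qed

lemma v_nonzero: "0 < (norm v)\<^sup>2"
  using forward by auto

lemma D_v_pos: "0 < D v"
  using v_nonzero \<mu> by (simp add: dform_shift rq)

lemma N_form: "dform (\<lambda>j. m i - m j) z = m i * (norm z)\<^sup>2 - dform m z"
  by (simp add: dform_def norm_sq_eq sum_subtractf sum_distrib_left left_diff_distrib)

lemma ratio_ball:
  assumes h: "norm h \<le> norm res"
  shows "N (Bv + h) * D v \<le> N v * D (Bv + h)"
proof -
  let ?w = "Bv + h"
  have "dform (\<lambda>j. m i - m j) ?w * dform (\<lambda>j. m j - \<mu>\<^sub>2) v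
      \<le> dform (\<lambda>j. m i - m j) v * dform (\<lambda>j. m j - \<mu>\<^sub>2) ?w"
  proof -
    have "0 \<le> (norm v)\<^sup>2 * (m i - \<mu>\<^sub>2) * (dform m ?w - \<mu> * (norm ?w)\<^sup>2)"
      using rayleigh_ball[OF h] \<mu> by simp
    then show ?thesis
      by (simp add: N_form dform_shift rq algebra_simps)
  qed
  then have "sqrt (dform (\<lambda>j. m i - m j) ?w * dform (\<lambda>j. m j - \<mu>\<^sub>2) v)
      \<le> sqrt (dform (\<lambda>j. m i - m j) v * dform (\<lambda>j. m j - \<mu>\<^sub>2) ?w)"
    by (rule real_sqrt_le_mono)
  then show ?thesis
    by (simp only: real_sqrt_mult)
qed

text \<open>The point \<open>w\<close> is the mean \<open>(1 - \<gamma>) Bv + \<gamma> w\<^sub>1\<close> of the exact image, which improves the ratio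
\<open>N / D\<close> by the factor \<open>\<mu>\<^sub>2 / m i\<close>, and a point \<open>w\<^sub>1\<close> of the full ball, which does not worsen it.
If \<open>D w\<^sub>1 < D Bv\<close>, the mean puts at most the weight \<open>\<gamma>\<close> on the unimproved ratio, and this
is the claim. Otherwise that weight may exceed \<open>\<gamma>\<close>, but then \<open>D w \<ge> D Bv \<ge> m i * D v\<close>, and
the estimates \<open>N Bv \<le> \<mu>\<^sub>2 * N v\<close> and \<open>N w\<^sub>1 \<le> m i * N v\<close> of the numerators alone give the same factor.\<close>

theorem contraction:
  assumes w: "norm (w - Bv) \<le> \<gamma> * norm res" and \<gamma>: "0 \<le> \<gamma>" "\<gamma> < 1"
  shows "0 < D w" and "N w * D v \<le> (\<gamma> + (1 - \<gamma>) * (\<mu>\<^sub>2 / m i)) * N v * D w"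
proof -
  \<comment> \<open>for \<open>\<gamma> = 0\<close> the hypothesis forces \<open>w = Bv\<close>, and any point of the full ball serves as \<open>w\<^sub>1\<close>\<close>
  define h where "h = (if \<gamma> = 0 then 0 else (1 / \<gamma>) *\<^sub>R (w - Bv))"
  have h: "norm h \<le> norm res"
    using w \<gamma> by (auto simp: h_def divide_simps mult.commute)
  have w_eq: "w = (1 - \<gamma>) *\<^sub>R Bv + \<gamma> *\<^sub>R (Bv + h)"
    using w by (auto simp: h_def algebra_simps)
  define w\<^sub>1 where "w\<^sub>1 = Bv + h"
  have D0: "m i * D v \<le> D Bv" and Dpos: "0 < D Bv"
    using D_image less_le_trans[OF mult_pos_pos[OF m_pos[of i] D_v_pos] D_image] by simp_all
  have form1: "0 \<le> dform (\<lambda>j. m j - \<mu>\<^sub>2) w\<^sub>1"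
  proof -
    have "\<mu>\<^sub>2 * (norm w\<^sub>1)\<^sup>2 \<le> \<mu> * (norm w\<^sub>1)\<^sup>2"
      using \<mu> by (intro mult_right_mono) auto
    then show ?thesis
      using rayleigh_ball[OF h] by (simp add: dform_shift w\<^sub>1_def)
  qed
  have Dw: "(1 - \<gamma>) * D Bv + \<gamma> * D w\<^sub>1 \<le> D w"
  proof -
    have "sqrt (dform (\<lambda>j. m j - \<mu>\<^sub>2) ((1 - \<gamma>) *\<^sub>R Bv)) + sqrt (dform (\<lambda>j. m j - \<mu>\<^sub>2) (\<gamma> *\<^sub>R w\<^sub>1))
        \<le> sqrt (dform (\<lambda>j. m j - \<mu>\<^sub>2) ((1 - \<gamma>) *\<^sub>R Bv + \<gamma> *\<^sub>R w\<^sub>1))"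
    proof (rule dform_reverse_triangle[where i = i])
      show "0 \<le> ((1 - \<gamma>) *\<^sub>R Bv) $ i"
        using \<gamma> forward m_pos[of i] by (simp add: Bv_def)
      show "0 \<le> (\<gamma> *\<^sub>R w\<^sub>1) $ i"
        using \<gamma> forward_ball[OF h] by (simp add: w\<^sub>1_def)
    qed (use m_le \<mu> form1 Dpos in \<open>auto simp: dform_scaleR less_imp_le\<close>)
    then show ?thesis
      using \<gamma> by (simp add: sqrt_dform_scaleR w_eq w\<^sub>1_def)
  qed
  have Nw: "N w \<le> (1 - \<gamma>) * N Bv + \<gamma> * N w\<^sub>1"
  proof -
    have "N w \<le> N ((1 - \<gamma>) *\<^sub>R Bv) + N (\<gamma> *\<^sub>R w\<^sub>1)"
      unfolding w_eq w\<^sub>1_def by (rule dform_triangle) (simp add: m_le_top)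
    then show ?thesis
      using \<gamma> by (simp add: sqrt_dform_scaleR)
  qed
  have D1: "0 \<le> D w\<^sub>1"
    using form1 by simp
  have "0 < (1 - \<gamma>) * D Bv + \<gamma> * D w\<^sub>1"
    using \<gamma> Dpos D1 by (intro add_pos_nonneg) auto
  then show "0 < D w"
    using Dw by linarith
  have Nv: "0 \<le> N v"
    by (simp add: dform_nonneg m_le_top)
  define q where "q = \<mu>\<^sub>2 / m i"
  have q: "0 \<le> q" "q \<le> 1" and \<mu>\<^sub>2_eq: "\<mu>\<^sub>2 = q * m i"
    using \<mu> m_pos[of i] by (auto simp: q_def)
  show "N w * D v \<le> (\<gamma> + (1 - \<gamma>) * (\<mu>\<^sub>2 / m i)) * N v * D w"
    unfolding q_def[symmetric]
  proof (cases "D Bv \<le> D w\<^sub>1")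
    case True
    have "N w \<le> (1 - \<gamma>) * (\<mu>\<^sub>2 * N v) + \<gamma> * (m i * N v)"
      using Nw \<gamma> mult_left_mono[OF N_image, of "1 - \<gamma>"] mult_left_mono[OF N_ball[OF h], of \<gamma>]
      unfolding w\<^sub>1_def by linarith
    also have "\<dots> = (\<gamma> + (1 - \<gamma>) * q) * N v * m i"
      by (simp add: \<mu>\<^sub>2_eq algebra_simps)
    finally have "N w * D v \<le> (\<gamma> + (1 - \<gamma>) * q) * N v * m i * D v"
      using D_v_pos by (intro mult_right_mono) auto
    also have "\<dots> = (\<gamma> + (1 - \<gamma>) * q) * N v * (m i * D v)"
      by simp
    also have "\<dots> \<le> (\<gamma> + (1 - \<gamma>) * q) * N v * D w"
    proof (rule mult_left_mono)
      have "D Bv = (1 - \<gamma>) * D Bv + \<gamma> * D Bv"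
        by (simp add: algebra_simps)
      also have "\<dots> \<le> (1 - \<gamma>) * D Bv + \<gamma> * D w\<^sub>1"
        using True \<gamma> by (simp add: mult_left_mono)
      finally show "m i * D v \<le> D w"
        using D0 Dw by linarith
      show "0 \<le> (\<gamma> + (1 - \<gamma>) * q) * N v"
        using Nv q \<gamma> by simp
    qed
    finally show "N w * D v \<le> (\<gamma> + (1 - \<gamma>) * q) * N v * D w" .
  next
    case False
    have Bv: "N Bv * D v \<le> q * N v * D Bv"
    proof -
      have "N Bv * D v \<le> q * m i * N v * D v"
        using N_image D_v_pos unfolding \<mu>\<^sub>2_eq by (intro mult_right_mono) auto
      also have "\<dots> = q * N v * (m i * D v)"
        by simp
      also have "\<dots> \<le> q * N v * D Bv"
        using D0 q Nv by (intro mult_left_mono) auto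
      finally show ?thesis .
    qed
    have "N w * D v \<le> ((1 - \<gamma>) * N Bv + \<gamma> * N w\<^sub>1) * D v"
      using Nw D_v_pos by (intro mult_right_mono) auto
    also have "\<dots> = (1 - \<gamma>) * (N Bv * D v) + \<gamma> * (N w\<^sub>1 * D v)"
      by (simp add: algebra_simps)
    also have "\<dots> \<le> (1 - \<gamma>) * (q * N v * D Bv) + \<gamma> * (N v * D w\<^sub>1)"
      using Bv ratio_ball[OF h] \<gamma> unfolding w\<^sub>1_def[symmetric]
      by (intro add_mono mult_left_mono) auto
    also have "\<dots> = N v * ((1 - \<gamma>) * q * D Bv + \<gamma> * D w\<^sub>1)"
      by (simp add: algebra_simps)
    also have "\<dots> \<le> N v * ((\<gamma> + (1 - \<gamma>) * q) * ((1 - \<gamma>) * D Bv + \<gamma> * D w\<^sub>1))"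
    proof (rule mult_left_mono[OF _ Nv])
      \<comment> \<open>Chebyshev: the smaller ratio \<open>q\<close> carries the larger weight \<open>D Bv\<close>; the right-hand side
        exceeds the left-hand side by exactly this product\<close>
      have "0 \<le> \<gamma> * (1 - \<gamma>) * (1 - q) * (D Bv - D w\<^sub>1)"
        using \<gamma> q False by simp
      then show "(1 - \<gamma>) * q * D Bv + \<gamma> * D w\<^sub>1
          \<le> (\<gamma> + (1 - \<gamma>) * q) * ((1 - \<gamma>) * D Bv + \<gamma> * D w\<^sub>1)"
        by (simp add: algebra_simps)
    qed
    also have "\<dots> \<le> N v * ((\<gamma> + (1 - \<gamma>) * q) * D w)"
      using Dw Nv q \<gamma> by (intro mult_left_mono) auto
    finally show "N w * D v \<le> (\<gamma> + (1 - \<gamma>) * q) * N v * D w"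
      by (simp add: mult_ac)
  qed
qed

end

section \<open>Rounding errors in the residual\<close>

lemma norm_mult_vec_le: "norm (M *v x) \<le> spectral_norm M * norm x"
  unfolding spectral_norm_def by (rule onorm) (rule matrix_vector_mul_bounded_linear)

lemma spectral_norm_nonneg: "0 \<le> spectral_norm M"
  unfolding spectral_norm_def by (rule onorm_pos_le) (rule matrix_vector_mul_bounded_linear)

lemma norm_fl_vec_error:
  assumes "fl_vec u e c"
  shows "norm (c - e) \<le> u * norm e"
proof -
  have "norm ((c - e) $ j) \<le> norm ((u *\<^sub>R e) $ j)" for j
  proof -
    obtain \<delta> where "\<bar>\<delta>\<bar> \<le> u" "c $ j = e $ j * (1 + \<delta>)"
      using assms by (auto simp: fl_vec_def fl_def)
    then show ?thesis
      by (simp add: algebra_simps abs_mult mult_right_mono)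
  qed
  then have "norm (c - e) \<le> norm (u *\<^sub>R e)"
    by (rule norm_le_componentwise_cart)
  moreover have "0 \<le> u"
    using assms by (force simp: fl_vec_def fl_def)
  ultimately show ?thesis
    by simp
qed

lemma fl_inner_error:
  fixes v w :: "real ^ 'n"
  assumes "fl_inner u v w c" and "0 \<le> gam CARD('n) u"
  shows "\<bar>c - v \<bullet> w\<bar> \<le> gam CARD('n) u * (norm v * norm w)"
proof -
  have "(\<Sum>j\<in>UNIV. \<bar>v $ j\<bar> * \<bar>w $ j\<bar>) \<le> norm v * norm w"
    using L2_set_mult_ineq[of "\<lambda>j. v $ j" "\<lambda>j. w $ j" UNIV] by (simp add: norm_vec_def L2_set_def)
  then have "gam CARD('n) u * (\<Sum>j\<in>UNIV. \<bar>v $ j\<bar> * \<bar>w $ j\<bar>) \<le> gam CARD('n) u * (norm v * norm w)"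
    using assms(2) by (rule mult_left_mono)
  then show ?thesis
    using assms(1) unfolding fl_inner_def by linarith
qed

text \<open>Here \<open>\<rho> + \<sigma>\<close> and \<open>1 + \<theta>\<close> are the computed numerator and denominator of the Rayleigh quotient, both
divided by the exact denominator. The bound has the factor \<open>n + 1\<close> because multiplying numerator
and denominator of the error by \<open>1 - n u\<close> turns \<open>gam n u\<close> into \<open>n u\<close>, while
\<open>(1 + u) (1 - n u) \<le> 1\<close> absorbs the rounding error of the division in the term with \<open>c\<close>.\<close>

lemma quotient_error:
  fixes a c u \<rho> \<sigma> \<theta> \<delta> :: real
  assumes n: "1 \<le> n" and u: "0 \<le> u" "2 * real n * u < 1"
    and \<rho>: "\<bar>\<rho>\<bar> \<le> a" and \<sigma>: "\<bar>\<sigma>\<bar> \<le> c" and \<theta>: "\<bar>\<theta>\<bar> \<le> gam n u" and \<delta>: "\<bar>\<delta>\<bar> \<le> u"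
  shows "\<bar>(\<rho> + \<sigma>) / (1 + \<theta>) * (1 + \<delta>) - \<rho>\<bar> \<le> (c + (real n + 1) * u * a) / (1 - 2 * real n * u)"
proof -
  let ?k = "real n * u"
  have k: "0 \<le> ?k" "2 * ?k < 1" "u \<le> ?k"
    using u n mult_right_mono[of 1 "real n" u] by auto
  have g: "gam n u * (1 - ?k) = ?k"
    using k by (simp add: gam_def)
  have ac: "0 \<le> a" "0 \<le> c"
    using \<rho> \<sigma> by auto
  have \<theta>_lower: "1 - 2 * ?k \<le> (1 + \<theta>) * (1 - ?k)"
  proof -
    have "(1 - gam n u) * (1 - ?k) \<le> (1 + \<theta>) * (1 - ?k)"
      using \<theta> k by (intro mult_right_mono) auto
    then show ?thesis
      using g by (simp add: algebra_simps)
  qed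
  then have "0 < (1 + \<theta>) * (1 - ?k)"
    using k by linarith
  then have pos: "0 < 1 + \<theta>"
    by (rule zero_less_mult_pos2) (use k in linarith)
  have "\<bar>\<sigma> * (1 + \<delta>) + (\<delta> - \<theta>) * \<rho>\<bar> \<le> c * (1 + u) + (u + gam n u) * a"
  proof -
    have "\<bar>\<sigma> * (1 + \<delta>)\<bar> \<le> c * (1 + u)" "\<bar>(\<delta> - \<theta>) * \<rho>\<bar> \<le> (u + gam n u) * a"
      unfolding abs_mult using \<sigma> \<delta> \<theta> \<rho> ac by (intro mult_mono; linarith)+
    then show ?thesis
      by linarith
  qed
  then have "\<bar>\<sigma> * (1 + \<delta>) + (\<delta> - \<theta>) * \<rho>\<bar> * (1 - ?k) \<le> (c * (1 + u) + (u + gam n u) * a) * (1 - ?k)"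
    using k by (intro mult_right_mono) auto
  also have "\<dots> = c * ((1 + u) * (1 - ?k)) + (u * (1 - ?k) + gam n u * (1 - ?k)) * a"
    by (simp add: algebra_simps)
  also have "\<dots> \<le> c * 1 + (u + ?k) * a"
  proof (intro add_mono mult_left_mono mult_right_mono)
    have "0 \<le> u * ?k"
      using u k by simp
    then show "(1 + u) * (1 - ?k) \<le> 1" "u * (1 - ?k) \<le> u"
      using k by (auto simp: algebra_simps)
  qed (use g ac in auto)
  finally have num: "\<bar>\<sigma> * (1 + \<delta>) + (\<delta> - \<theta>) * \<rho>\<bar> * (1 - ?k) \<le> c + (real n + 1) * u * a"
    by (simp add: algebra_simps)
  have "(\<rho> + \<sigma>) / (1 + \<theta>) * (1 + \<delta>) - \<rho> = (\<sigma> * (1 + \<delta>) + (\<delta> - \<theta>) * \<rho>) / (1 + \<theta>)"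
    using pos by (simp add: field_simps)
  then have "\<bar>(\<rho> + \<sigma>) / (1 + \<theta>) * (1 + \<delta>) - \<rho>\<bar>
      = (\<bar>\<sigma> * (1 + \<delta>) + (\<delta> - \<theta>) * \<rho>\<bar> * (1 - ?k)) / ((1 + \<theta>) * (1 - ?k))"
    using pos k by (simp add: abs_mult)
  also have "\<dots> \<le> (c + (real n + 1) * u * a) / (1 - 2 * ?k)"
    using num \<theta>_lower k u ac by (intro frac_le add_nonneg_nonneg mult_nonneg_nonneg) auto
  finally show ?thesis
    by (simp add: mult.assoc)
qed

lemma abs_rayleigh_le: "\<bar>rayleigh A x\<bar> \<le> spectral_norm A"
proof (cases "x = 0")
  case False
  have "\<bar>x \<bullet> (A *v x)\<bar> \<le> norm x * (spectral_norm A * norm x)"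
    using Cauchy_Schwarz_ineq2[of x "A *v x"] mult_left_mono[OF norm_mult_vec_le[of A x], of "norm x"]
    by simp
  then have "\<bar>x \<bullet> (A *v x)\<bar> \<le> spectral_norm A * (x \<bullet> x)"
    by (simp add: dot_square_norm power2_eq_square mult_ac)
  then show ?thesis
    using False by (simp add: rayleigh_def abs_divide divide_simps)
qed (simp add: rayleigh_def spectral_norm_nonneg)

text \<open>The error of the residual is split into two parts of different nature. The part \<open>g\<close>, from the
matrix-vector product, the Rayleigh quotient and the scaling, is proportional to \<open>norm x\<close>. The part
\<open>e\<close>, from the final subtraction, is proportional to the computed difference, hence up to \<open>g\<close> to the
residual itself. It is later charged to the term with \<open>gam 2 u\<close>, which multiplies the residual, so
that \<open>\<epsilon>\<^sub>r\<close> has to account for \<open>g\<close> only.\<close>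

theorem fl_residual_error:
  fixes A :: "real ^ 'n ^ 'n" and x r :: "real ^ 'n" and u \<epsilon> :: real
  defines "n \<equiv> CARD('n)" and "\<rho> \<equiv> rayleigh A x" and "a \<equiv> spectral_norm A"
  defines "\<epsilon>\<^sub>r \<equiv> (gam n u + \<epsilon> + gam n u * \<epsilon> + (real n + 1) * u) * ((1 + u) / (1 - 2 * real n * u)) + \<epsilon> + u"
  assumes fl: "fl_residual u \<epsilon> A x r" and x: "x \<noteq> 0" and u: "0 \<le> u" "2 * real n * u < 1"
  obtains g e where "r = A *v x - \<rho> *\<^sub>R x + g + e" and "norm g \<le> \<epsilon>\<^sub>r * a * norm x"
    and "norm e \<le> u * (norm (A *v x - \<rho> *\<^sub>R x) + norm g)"
proof -
  obtain y s t q z E where E: "spectral_norm E \<le> \<epsilon> * a" "y = (A + E) *v x"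
    and s: "fl_inner u x y s" and t: "fl_inner u x x t" and q: "fl u (s / t) q"
    and z: "fl_vec u (q *\<^sub>R x) z" and r: "fl_vec u (y - z) r"
    using fl unfolding fl_residual_def fl_matvec_def a_def by auto
  have n: "1 \<le> n"
    by (simp add: n_def Suc_le_eq)
  have gam: "0 \<le> gam n u"
    using u n by (simp add: gam_def)
  have a: "0 \<le> a"
    by (simp add: a_def spectral_norm_nonneg)
  have Ex: "norm (E *v x) \<le> \<epsilon> * a * norm x"
    using norm_mult_vec_le[of E x] mult_right_mono[OF E(1), of "norm x"] by simp
  have y: "y = A *v x + E *v x"
    by (simp add: E matrix_vector_mult_add_rdistrib)
  have norm_y: "norm y \<le> (1 + \<epsilon>) * a * norm x"
    using norm_triangle_ineq[of "A *v x" "E *v x"] norm_mult_vec_le[of A x] Ex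
    by (simp add: y a_def algebra_simps)
  define N where "N = (norm x)\<^sup>2"
  have N: "0 < N"
    using x by (simp add: N_def)
  have xAx: "x \<bullet> (A *v x) = \<rho> * N"
    using x by (simp add: \<rho>_def rayleigh_def N_def dot_square_norm)
  define c where "c = (gam n u + \<epsilon> + gam n u * \<epsilon>) * a"
  have "\<bar>s - \<rho> * N\<bar> \<le> c * N"
  proof -
    have "\<bar>s - x \<bullet> y\<bar> \<le> gam n u * (norm x * norm y)"
      using fl_inner_error[OF s] gam by (simp add: n_def)
    also have "\<dots> \<le> gam n u * (norm x * ((1 + \<epsilon>) * a * norm x))"
      using norm_y gam by (intro mult_left_mono) auto
    finally have 1: "\<bar>s - x \<bullet> y\<bar> \<le> gam n u * (1 + \<epsilon>) * a * N"
      by (simp add: N_def power2_eq_square mult_ac)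
    have "\<bar>x \<bullet> (E *v x)\<bar> \<le> norm x * (\<epsilon> * a * norm x)"
      using Cauchy_Schwarz_ineq2[of x "E *v x"] mult_left_mono[OF Ex, of "norm x"] by simp
    then have 2: "\<bar>x \<bullet> (E *v x)\<bar> \<le> \<epsilon> * a * N"
      by (simp add: N_def power2_eq_square mult_ac)
    have "s - \<rho> * N = (s - x \<bullet> y) + x \<bullet> (E *v x)"
      by (simp add: y inner_add_right xAx)
    then have "\<bar>s - \<rho> * N\<bar> \<le> gam n u * (1 + \<epsilon>) * a * N + \<epsilon> * a * N"
      using 1 2 by linarith
    then show ?thesis
      by (simp add: c_def algebra_simps)
  qed
  then have \<sigma>: "\<bar>s / N - \<rho>\<bar> \<le> c"
    using N by (simp add: abs_le_iff field_simps)
  have "\<bar>t - N\<bar> \<le> gam n u * N"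
    using fl_inner_error[OF t] gam by (simp add: n_def N_def dot_square_norm power2_eq_square)
  then have \<theta>: "\<bar>t / N - 1\<bar> \<le> gam n u"
    using N by (simp add: abs_le_iff field_simps)
  obtain \<delta> where \<delta>: "\<bar>\<delta>\<bar> \<le> u" "q = s / t * (1 + \<delta>)"
    using q by (auto simp: fl_def)
  define \<Delta> where "\<Delta> = (c + (real n + 1) * u * a) / (1 - 2 * real n * u)"
  have "(\<rho> + (s / N - \<rho>)) / (1 + (t / N - 1)) = s / t"
    using N by simp
  moreover have \<rho>_le: "\<bar>\<rho>\<bar> \<le> a"
    by (simp add: \<rho>_def a_def abs_rayleigh_le)
  ultimately have dq: "\<bar>q - \<rho>\<bar> \<le> \<Delta>"
    using quotient_error[OF n u \<rho>_le \<sigma> \<theta> \<delta>(1)] by (simp only: \<delta>(2) \<Delta>_def)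
  define g where "g = (y - z) - (A *v x - \<rho> *\<^sub>R x)"
  define e where "e = r - (y - z)"
  have "norm (z - \<rho> *\<^sub>R x) \<le> (u * a + (1 + u) * \<Delta>) * norm x"
  proof -
    have "norm (z - \<rho> *\<^sub>R x) \<le> norm (z - q *\<^sub>R x) + norm ((q - \<rho>) *\<^sub>R x)"
      using norm_triangle_ineq[of "z - q *\<^sub>R x" "(q - \<rho>) *\<^sub>R x"] by (simp add: algebra_simps)
    also have "\<dots> \<le> (u * \<bar>q\<bar> + \<bar>q - \<rho>\<bar>) * norm x"
      using norm_fl_vec_error[OF z] by (simp add: distrib_right mult.assoc)
    also have "\<dots> \<le> (u * (a + \<Delta>) + \<Delta>) * norm x"
    proof (intro mult_right_mono add_mono mult_left_mono)
      show "\<bar>q\<bar> \<le> a + \<Delta>"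
        using dq abs_rayleigh_le[of A x] by (simp add: \<rho>_def a_def)
    qed (use dq u in auto)
    finally show ?thesis
      by (simp add: algebra_simps)
  qed
  moreover have g_eq: "g = E *v x - (z - \<rho> *\<^sub>R x)"
    by (simp add: g_def y)
  ultimately have "norm g \<le> \<epsilon> * a * norm x + (u * a + (1 + u) * \<Delta>) * norm x"
    using norm_triangle_ineq4[of "E *v x" "z - \<rho> *\<^sub>R x"] Ex unfolding g_eq by linarith
  also have "\<dots> = \<epsilon>\<^sub>r * a * norm x"
    by (simp add: \<epsilon>\<^sub>r_def c_def \<Delta>_def add_divide_distrib algebra_simps)
  finally have g: "norm g \<le> \<epsilon>\<^sub>r * a * norm x" .
  have "norm e \<le> u * norm ((A *v x - \<rho> *\<^sub>R x) + g)"
    using norm_fl_vec_error[OF r] by (simp add: e_def g_def)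
  also have "\<dots> \<le> u * (norm (A *v x - \<rho> *\<^sub>R x) + norm g)"
    using u by (intro mult_left_mono norm_triangle_ineq)
  finally show thesis
    using g by (intro that[of g e]) (simp_all add: e_def g_def)
qed

lemma norm_coords:
  fixes P :: "real ^ 'n ^ 'n"
  assumes "orthogonal_matrix P"
  shows "norm (transpose P *v x) = norm x"
  using coords_inner[OF assms, of x x] by (simp add: norm_eq del: transpose_matrix_vector)

lemma dform_coords:
  fixes P :: "real ^ 'n ^ 'n"
  assumes "orthogonal_matrix P"
  shows "x \<bullet> (spectral_fun P f *v x) = dform f (transpose P *v x)"
  unfolding inner_spectral_fun[OF assms] dform_def ..

section \<open>Preconditioned inverse iteration for a matrix with a spectral gap\<close>

text \<open>The matrix under consideration has the eigenvalues \<open>d\<close> in the eigenbasis \<open>P\<close>, the smallest one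
\<open>l\<^sub>1\<close> being simple and all others at least \<open>l\<^sub>2\<close>. Below, \<open>S\<close> is its square root and \<open>R\<close> the inverse
of \<open>S\<close>, so that \<open>S *v x - \<rho> *\<^sub>R (R *v x)\<close> is the residual \<open>A *v x - \<rho> *\<^sub>R x\<close> scaled by \<open>R\<close>.\<close>

locale spd_gap =
  fixes P :: "real ^ 'n ^ 'n" and d :: "'n \<Rightarrow> real" and i :: 'n and l\<^sub>1 l\<^sub>2 :: real
  assumes P: "orthogonal_matrix P" and d_i: "d i = l\<^sub>1" and d_ge: "\<And>j. j \<noteq> i \<Longrightarrow> l\<^sub>2 \<le> d j"
    and l: "0 < l\<^sub>1" "l\<^sub>1 < l\<^sub>2"
begin

definition A :: "real ^ 'n ^ 'n" where "A = spectral_fun P d"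
definition S :: "real ^ 'n ^ 'n" where "S = spectral_fun P (\<lambda>j. sqrt (d j))"
definition R :: "real ^ 'n ^ 'n" where "R = spectral_fun P (\<lambda>j. 1 / sqrt (d j))"
definition coords :: "real ^ 'n \<Rightarrow> real ^ 'n" where "coords x = transpose P *v x"

lemma d_pos: "0 < d j"
  using d_i d_ge[of j] l by (cases "j = i") auto

lemma coords_nonzero: "coords x \<noteq> 0 \<longleftrightarrow> x \<noteq> 0"
  using norm_coords[OF P, of x] unfolding coords_def by (metis norm_eq_zero)

lemma inner_A: "x \<bullet> (A *v x) = dform d (coords x)"
  unfolding A_def coords_def by (rule dform_coords[OF P])

lemma rayleigh_A: "rayleigh A x = dform d (coords x) / (norm (coords x))\<^sup>2"
  by (simp only: rayleigh_def inner_A coords_def norm_coords[OF P] dot_square_norm)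

lemma coords_shifted_residual:
  "coords (S *v y - \<rho> *\<^sub>R (R *v x)) = (\<chi> j. sqrt (d j) * coords y $ j - \<rho> * coords x $ j / sqrt (d j))"
  unfolding coords_def S_def R_def matrix_vector_mult_diff_distrib matrix_vector_mult_scaleR
    coords_spectral_fun[OF P]
  by (simp add: vec_eq_iff)

lemma S_R: "S ** R = mat 1" and S_S: "S ** S = A"
proof -
  have "sqrt (d j) * sqrt (d j) = d j" "sqrt (d j) \<noteq> 0" for j
    using d_pos[of j] by auto
  then show "S ** R = mat 1" "S ** S = A"
    by (simp_all add: R_def S_def A_def spectral_fun_mult[OF P] spectral_fun_const[OF P])
qed

lemma norm_S_le: "norm (S *v y) \<le> sqrt (spectral_norm A) * norm y"
proof (rule power2_le_imp_le)
  have "(norm (S *v y))\<^sup>2 = y \<bullet> (A *v y)"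
    unfolding S_S[symmetric] using transpose_spectral_fun[of P]
    by (simp add: S_def inner_symmetric_matrix dot_square_norm flip: matrix_vector_mul_assoc)
  also have "\<dots> \<le> norm y * (spectral_norm A * norm y)"
    using norm_cauchy_schwarz[of y "A *v y"] mult_left_mono[OF norm_mult_vec_le[of A y], of "norm y"]
    by simp
  also have "\<dots> = (sqrt (spectral_norm A) * norm y)\<^sup>2"
    using spectral_norm_nonneg[of A] by (simp add: power_mult_distrib power2_eq_square)
  finally show "(norm (S *v y))\<^sup>2 \<le> (sqrt (spectral_norm A) * norm y)\<^sup>2" .
qed (simp add: spectral_norm_nonneg)

lemma spectral_norm_A_le:
  assumes "\<And>j. d j \<le> b"
  shows "spectral_norm A \<le> b"
  unfolding spectral_norm_def
proof (rule onorm_bound)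
  show "0 \<le> b"
    using assms[of i] d_pos[of i] by simp
  fix x :: "real ^ 'n"
  show "norm (A *v x) \<le> b * norm x"
  proof (rule power2_le_imp_le)
    have "(norm (A *v x))\<^sup>2 \<le> (\<Sum>j\<in>UNIV. (b * coords x $ j)\<^sup>2)"
      unfolding A_def norm_spectral_fun[OF P] coords_def[symmetric] power_mult_distrib
      using assms d_pos by (intro sum_mono mult_right_mono power_mono) (auto intro: less_imp_le)
    also have "\<dots> = (b * norm (coords x))\<^sup>2"
      by (simp add: norm_vec_def L2_set_def sum_nonneg power_mult_distrib sum_distrib_left)
    finally show "(norm (A *v x))\<^sup>2 \<le> (b * norm x)\<^sup>2"
      by (simp only: coords_def norm_coords[OF P])
  qed (use \<open>0 \<le> b\<close> in simp)
qed

text \<open>In eigencoordinates the scaled residual multiplies component \<open>j\<close> by \<open>(d j - \<rho>) / sqrt (d j)\<close>.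
This function of \<open>d j\<close> is increasing, and \<open>\<rho>\<close> lies between \<open>l\<^sub>1\<close> and \<open>l\<^sub>2\<close>, so over the
possible eigenvalues its modulus is smallest at \<open>l\<^sub>1\<close> or at \<open>l\<^sub>2\<close>; these two points give the two
entries of the maximum.\<close>

lemma norm_le_scaled_residual:
  assumes \<rho>: "l\<^sub>1 < \<rho>" "\<rho> < l\<^sub>2" and b: "0 \<le> b"
  shows "sqrt b * norm x
    \<le> max (sqrt (l\<^sub>1 * b) / (\<rho> - l\<^sub>1)) (sqrt (l\<^sub>2 * b) / (l\<^sub>2 - \<rho>)) * norm (S *v x - \<rho> *\<^sub>R (R *v x))"
    (is "_ \<le> ?\<beta> * norm ?p")
proof -
  have \<beta>: "0 \<le> ?\<beta>"
    using \<rho> b l by (simp add: le_max_iff_disj)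
  have comp: "sqrt b \<le> ?\<beta> * \<bar>sqrt (d j) - \<rho> / sqrt (d j)\<bar>" for j
  proof (cases "j = i")
    case True
    have "\<bar>sqrt (d j) - \<rho> / sqrt (d j)\<bar> = (\<rho> - l\<^sub>1) / sqrt l\<^sub>1"
      using l \<rho> by (simp add: True d_i abs_if field_simps)
    moreover have "sqrt (l\<^sub>1 * b) / (\<rho> - l\<^sub>1) * ((\<rho> - l\<^sub>1) / sqrt l\<^sub>1) = sqrt b"
      using l \<rho> by (simp add: real_sqrt_mult)
    moreover have "sqrt (l\<^sub>1 * b) / (\<rho> - l\<^sub>1) * ((\<rho> - l\<^sub>1) / sqrt l\<^sub>1) \<le> ?\<beta> * ((\<rho> - l\<^sub>1) / sqrt l\<^sub>1)"
      using l \<rho> by (intro mult_right_mono) auto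
    ultimately show ?thesis
      by simp
  next
    case False
    have le: "sqrt l\<^sub>2 \<le> sqrt (d j)" and pos: "0 < sqrt l\<^sub>2"
      using d_ge[OF False] l by auto
    have "\<rho> / sqrt (d j) \<le> \<rho> / sqrt l\<^sub>2"
      using le pos \<rho> l by (intro divide_left_mono) auto
    moreover have "(l\<^sub>2 - \<rho>) / sqrt l\<^sub>2 = sqrt l\<^sub>2 - \<rho> / sqrt l\<^sub>2"
      using pos l by (simp add: diff_divide_distrib real_div_sqrt)
    ultimately have "(l\<^sub>2 - \<rho>) / sqrt l\<^sub>2 \<le> \<bar>sqrt (d j) - \<rho> / sqrt (d j)\<bar>"
      using le by linarith
    then have "?\<beta> * ((l\<^sub>2 - \<rho>) / sqrt l\<^sub>2) \<le> ?\<beta> * \<bar>sqrt (d j) - \<rho> / sqrt (d j)\<bar>"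
      using \<beta> by (rule mult_left_mono)
    moreover have "sqrt (l\<^sub>2 * b) / (l\<^sub>2 - \<rho>) * ((l\<^sub>2 - \<rho>) / sqrt l\<^sub>2) = sqrt b"
      using pos \<rho> by (simp add: real_sqrt_mult)
    moreover have "sqrt (l\<^sub>2 * b) / (l\<^sub>2 - \<rho>) * ((l\<^sub>2 - \<rho>) / sqrt l\<^sub>2) \<le> ?\<beta> * ((l\<^sub>2 - \<rho>) / sqrt l\<^sub>2)"
      using pos \<rho> by (intro mult_right_mono) auto
    ultimately show ?thesis
      by linarith
  qed
  have "norm (sqrt b *\<^sub>R coords x) \<le> norm (?\<beta> *\<^sub>R coords ?p)"
  proof (rule norm_le_componentwise_cart)
    fix j
    have "sqrt b * \<bar>coords x $ j\<bar> \<le> ?\<beta> * \<bar>sqrt (d j) - \<rho> / sqrt (d j)\<bar> * \<bar>coords x $ j\<bar>"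
      using comp by (rule mult_right_mono) simp
    also have "\<dots> = ?\<beta> * \<bar>coords ?p $ j\<bar>"
      unfolding coords_shifted_residual by (simp add: algebra_simps flip: abs_mult)
    finally show "norm ((sqrt b *\<^sub>R coords x) $ j) \<le> norm ((?\<beta> *\<^sub>R coords ?p) $ j)"
      using b \<beta> by (simp only: vector_scaleR_component real_scaleR_def real_norm_def abs_mult
          abs_of_nonneg[OF \<beta>] abs_of_nonneg[OF real_sqrt_ge_zero[OF b]])
  qed
  then show ?thesis
    using b \<beta> by (simp only: norm_scaleR coords_def norm_coords[OF P]) simp
qed

text \<open>The substitution \<open>v = S *v x\<close>, \<open>w = (1 / \<rho>) *\<^sub>R (S *v y)\<close>, \<open>m j = 1 / d j\<close>, written in
eigencoordinates, turns the ball around \<open>\<rho> *\<^sub>R (R *v x)\<close> into the ball around \<open>Bv\<close> of the preceding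
part. Under it \<open>(N / D)\<^sup>2\<close> becomes \<open>(l\<^sub>2 / l\<^sub>1) * (rayleigh - l\<^sub>1) / (l\<^sub>2 - rayleigh)\<close>.\<close>

theorem pinvit_contraction:
  assumes x: "x \<noteq> 0" and \<rho>: "l\<^sub>1 < rayleigh A x" "rayleigh A x < l\<^sub>2"
    and ball: "norm (S *v y - rayleigh A x *\<^sub>R (R *v x))
                 \<le> \<gamma> * norm (S *v x - rayleigh A x *\<^sub>R (R *v x))"
    and \<gamma>: "0 \<le> \<gamma>" "\<gamma> < 1"
  shows "y \<noteq> 0 \<and> rayleigh A y < l\<^sub>2 \<and>
    (rayleigh A y - l\<^sub>1) / (l\<^sub>2 - rayleigh A y)
      \<le> (\<gamma> + (1 - \<gamma>) * (l\<^sub>1 / l\<^sub>2))\<^sup>2 * ((rayleigh A x - l\<^sub>1) / (l\<^sub>2 - rayleigh A x))"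
proof -
  define \<rho>' where "\<rho>' = rayleigh A x"
  have \<rho>': "0 < \<rho>'" "l\<^sub>1 < \<rho>'" "\<rho>' < l\<^sub>2"
    using \<rho> l by (auto simp: \<rho>'_def)
  define X where "X = (norm (coords x))\<^sup>2"
  define Y where "Y = (norm (coords y))\<^sup>2"
  have X: "0 < X"
    using x coords_nonzero by (simp add: X_def)
  have dX: "dform d (coords x) = \<rho>' * X"
    using X by (simp add: \<rho>'_def rayleigh_A X_def)
  \<comment> \<open>a vector without leading component has a Rayleigh quotient of at least \<open>l\<^sub>2\<close>\<close>
  have "coords x $ i \<noteq> 0"
  proof
    assume zero: "coords x $ i = 0"
    have "l\<^sub>2 * X = (\<Sum>j\<in>UNIV. l\<^sub>2 * (coords x $ j)\<^sup>2)"
      by (simp add: X_def norm_vec_def L2_set_def sum_nonneg sum_distrib_left)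
    also have "\<dots> \<le> dform d (coords x)"
      unfolding dform_def
    proof (rule sum_mono)
      fix j show "l\<^sub>2 * (coords x $ j)\<^sup>2 \<le> d j * (coords x $ j)\<^sup>2"
        using zero d_ge[of j] by (cases "j = i") (auto intro: mult_right_mono)
    qed
    finally show False
      using X \<rho>' by (simp add: dX)
  qed
  \<comment> \<open>\<open>x\<close> may point into the backward cone; the sign moves it to the forward one\<close>
  define s where "s = sgn (coords x $ i)"
  have s: "\<bar>s\<bar> = 1" "s\<^sup>2 = 1" "0 < s * coords x $ i"
    using \<open>coords x $ i \<noteq> 0\<close> by (auto simp: s_def sgn_if)
  define m where "m j = 1 / d j" for j
  define v where "v = (\<chi> j. s * sqrt (d j) * coords x $ j)"
  define w where "w = (\<chi> j. s / \<rho>' * sqrt (d j) * coords y $ j)"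
  have sq: "(sqrt (d j))\<^sup>2 = d j" "sqrt (d j) * sqrt (d j) = d j" "sqrt (d j) \<noteq> 0" "d j \<noteq> 0" for j
    using d_pos[of j] by (auto simp: less_imp_le)
  have form_v: "dform c v = dform (\<lambda>j. c j * d j) (coords x)" for c
    by (simp add: dform_def v_def power_mult_distrib s sq mult_ac)
  have form_w: "dform c w = dform (\<lambda>j. c j * d j) (coords y) / \<rho>'\<^sup>2" for c
    by (simp add: dform_def w_def power_mult_distrib power_divide s sq sum_divide_distrib mult_ac)
  have norm_form: "(norm z)\<^sup>2 = dform (\<lambda>_. 1) z" for z :: "real ^ 'n"
    by (simp add: dform_def norm_vec_def L2_set_def sum_nonneg)
  have "dform m v = 1 / \<rho>' * (norm v)\<^sup>2"
  proof -
    have "dform m v = X"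
      by (simp add: form_v m_def sq X_def norm_form)
    moreover have "(norm v)\<^sup>2 = \<rho>' * X"
      by (simp add: norm_form form_v dX)
    ultimately show ?thesis
      using \<rho>' by simp
  qed
  then interpret diagonal_iteration m i "1 / l\<^sub>2" "1 / \<rho>'" v
  proof (unfold_locales)
    show "0 < m j" for j
      using d_pos by (simp add: m_def)
    show "m j \<le> 1 / l\<^sub>2" if "j \<noteq> i" for j
      using d_ge[OF that] l by (simp add: m_def frac_le)
    show "0 < 1 / l\<^sub>2" "1 / l\<^sub>2 < 1 / \<rho>'" "1 / \<rho>' < m i"
      using l \<rho>' by (auto simp: m_def d_i frac_less2)
    show "0 < v $ i"
      using mult_pos_pos[OF s(3), of "sqrt (d i)"] d_pos[of i] by (simp add: v_def mult_ac)
  qed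
  have v_nth: "v $ j = s * sqrt (d j) * coords x $ j" for j
    by (simp add: v_def)
  have res: "res = (- s / \<rho>') *\<^sub>R coords (S *v x - \<rho>' *\<^sub>R (R *v x))"
    unfolding coords_shifted_residual using \<rho>' sq
    by (simp add: vec_eq_iff res_nth v_nth m_def field_simps)
  have diff: "w - Bv = (s / \<rho>') *\<^sub>R coords (S *v y - \<rho>' *\<^sub>R (R *v x))"
    unfolding coords_shifted_residual using \<rho>' sq
    by (simp add: vec_eq_iff Bv_nth v_nth w_def m_def field_simps)
  have "norm (w - Bv) = norm (S *v y - \<rho>' *\<^sub>R (R *v x)) / \<rho>'"
    unfolding diff norm_scaleR coords_def norm_coords[OF P] using s \<rho>' by simp
  also have "\<dots> \<le> \<gamma> * norm (S *v x - \<rho>' *\<^sub>R (R *v x)) / \<rho>'"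
    using ball \<rho>' by (simp add: divide_right_mono \<rho>'_def)
  also have "\<dots> = \<gamma> * norm res"
    unfolding res norm_scaleR coords_def norm_coords[OF P] using s \<rho>' by simp
  finally have w: "norm (w - Bv) \<le> \<gamma> * norm res" .
  define dY where "dY = dform d (coords y)"
  have N_sq: "dform (\<lambda>j. m i - m j) v = (\<rho>' - l\<^sub>1) * X / l\<^sub>1"
    and N_sq': "dform (\<lambda>j. m i - m j) w = (dY - l\<^sub>1 * Y) / (l\<^sub>1 * \<rho>'\<^sup>2)"
    and D_sq: "dform (\<lambda>j. m j - 1 / l\<^sub>2) v = (l\<^sub>2 - \<rho>') * X / l\<^sub>2"
    and D_sq': "dform (\<lambda>j. m j - 1 / l\<^sub>2) w = (l\<^sub>2 * Y - dY) / (l\<^sub>2 * \<rho>'\<^sup>2)"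
  proof -
    have "(\<lambda>j. (m i - m j) * d j) = (\<lambda>j. 1 / l\<^sub>1 * d j + (-1) * 1)"
      and "(\<lambda>j. (m j - 1 / l\<^sub>2) * d j) = (\<lambda>j. (- (1 / l\<^sub>2)) * d j + 1 * 1)"
      using sq by (auto simp: m_def d_i left_diff_distrib)
    note e = this[THEN arg_cong[where f = "\<lambda>c. dform c z" for z], unfolded dform_combination]
    show "dform (\<lambda>j. m i - m j) v = (\<rho>' - l\<^sub>1) * X / l\<^sub>1"
      "dform (\<lambda>j. m i - m j) w = (dY - l\<^sub>1 * Y) / (l\<^sub>1 * \<rho>'\<^sup>2)"
      "dform (\<lambda>j. m j - 1 / l\<^sub>2) v = (l\<^sub>2 - \<rho>') * X / l\<^sub>2"
      "dform (\<lambda>j. m j - 1 / l\<^sub>2) w = (l\<^sub>2 * Y - dY) / (l\<^sub>2 * \<rho>'\<^sup>2)"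
      unfolding form_v form_w e dX norm_form[symmetric] X_def[symmetric] Y_def[symmetric] dY_def[symmetric]
      using l \<rho>' by (simp_all add: field_simps)
  qed
  have "0 < (l\<^sub>2 * Y - dY) / (l\<^sub>2 * \<rho>'\<^sup>2)"
    using contraction(1)[OF w \<gamma>] by (simp only: D_sq' real_sqrt_gt_0_iff)
  moreover have "0 < l\<^sub>2 * \<rho>'\<^sup>2"
    using l \<rho>' by simp
  ultimately have pos: "0 < l\<^sub>2 * Y - dY"
    unfolding zero_less_divide_iff by linarith
  have "Y \<noteq> 0"
  proof
    assume "Y = 0"
    then have "coords y = 0"
      by (simp add: Y_def)
    then show False
      using pos by (simp add: Y_def dY_def dform_def)
  qed
  then have Y: "0 < Y"
    by (simp add: Y_def)
  define \<sigma> where "\<sigma> = \<gamma> + (1 - \<gamma>) * (l\<^sub>1 / l\<^sub>2)"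
  have \<sigma>_eq: "\<gamma> + (1 - \<gamma>) * (1 / l\<^sub>2 / m i) = \<sigma>"
    by (simp add: \<sigma>_def m_def d_i)
  have "(N w * D v)\<^sup>2 \<le> (\<sigma> * N v * D w)\<^sup>2"
    using contraction(2)[OF w \<gamma>] D_v_pos unfolding \<sigma>_eq
    by (intro power_mono) (auto simp: dform_nonneg m_le_top)
  then have "(dY - l\<^sub>1 * Y) / (l\<^sub>1 * \<rho>'\<^sup>2) * ((l\<^sub>2 - \<rho>') * X / l\<^sub>2)
      \<le> \<sigma>\<^sup>2 * ((\<rho>' - l\<^sub>1) * X / l\<^sub>1) * ((l\<^sub>2 * Y - dY) / (l\<^sub>2 * \<rho>'\<^sup>2))"
    unfolding power_mult_distrib N_sq[symmetric] N_sq'[symmetric] D_sq[symmetric] D_sq'[symmetric]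
    using contraction(1)[OF w \<gamma>] D_v_pos by (simp add: dform_nonneg m_le_top less_imp_le)
  then have "X / (l\<^sub>1 * l\<^sub>2 * \<rho>'\<^sup>2) * ((dY - l\<^sub>1 * Y) * (l\<^sub>2 - \<rho>'))
      \<le> X / (l\<^sub>1 * l\<^sub>2 * \<rho>'\<^sup>2) * (\<sigma>\<^sup>2 * (\<rho>' - l\<^sub>1) * (l\<^sub>2 * Y - dY))"
    by (simp add: mult_ac)
  then have ineq: "(dY - l\<^sub>1 * Y) * (l\<^sub>2 - \<rho>') \<le> \<sigma>\<^sup>2 * (\<rho>' - l\<^sub>1) * (l\<^sub>2 * Y - dY)"
    by (rule mult_left_le_imp_le) (use X l \<rho>' in simp)
  have ray_y: "rayleigh A y = dY / Y"
    by (simp add: rayleigh_A dY_def Y_def)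
  have "(rayleigh A y - l\<^sub>1) / (l\<^sub>2 - rayleigh A y) = (dY - l\<^sub>1 * Y) / (l\<^sub>2 * Y - dY)"
  proof -
    have "rayleigh A y - l\<^sub>1 = (dY - l\<^sub>1 * Y) / Y" "l\<^sub>2 - rayleigh A y = (l\<^sub>2 * Y - dY) / Y"
      using Y by (simp_all add: ray_y field_simps)
    then show ?thesis
      using Y by simp
  qed
  also have "\<dots> \<le> \<sigma>\<^sup>2 * ((\<rho>' - l\<^sub>1) / (l\<^sub>2 - \<rho>'))"
    using ineq pos \<rho>' by (simp add: divide_simps mult_ac)
  finally have "(rayleigh A y - l\<^sub>1) / (l\<^sub>2 - rayleigh A y) \<le> \<sigma>\<^sup>2 * ((\<rho>' - l\<^sub>1) / (l\<^sub>2 - \<rho>'))" .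
  moreover have "y \<noteq> 0"
    using Y coords_nonzero[of y] by (auto simp: Y_def)
  moreover have "rayleigh A y < l\<^sub>2"
    using pos Y by (simp add: ray_y divide_simps mult.commute)
  ultimately show ?thesis
    by (simp add: \<sigma>_def \<rho>'_def)
qed

end

section \<open>The computed step\<close>

lemma spectral_norm_mult_vec_le:
  assumes "norm y \<le> c"
  shows "norm (M *v y) \<le> spectral_norm M * c"
  using norm_mult_vec_le[of M y] mult_left_mono[OF assms spectral_norm_nonneg[of M]] by linarith

context spd_gap
begin

text \<open>In exact arithmetic \<open>S *v y - \<rho> *\<^sub>R (R *v x) = (I - S T S) p\<close> for the scaled residual \<open>p\<close>. The
errors add \<open>- S T (g + e) + S \<eta>\<close> with \<open>\<eta>\<close> the rounding error of the final subtraction. Everything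
proportional to the residual \<open>A *v x - \<rho> *\<^sub>R x = S *v p\<close> sums up to the coefficient
\<open>u + u (1 + u) = u (2 + u) \<le> gam 2 u\<close>: one \<open>u\<close> comes from \<open>e\<close>, the rest from the part of
\<open>\<eta>\<close> in which the computed residual enters. What is proportional to \<open>norm x\<close> is converted by the
assumed bound \<open>b\<close> into a multiple of \<open>norm p\<close>. The two factors \<open>sqrt a\<close> lost in passing through
\<open>S\<close> combine to \<open>a\<close>.\<close>

lemma computed_step_in_ball:
  fixes T :: "real ^ 'n ^ 'n" and x r y g e :: "real ^ 'n" and u \<epsilon> \<rho> b :: real
  defines "p \<equiv> S *v x - \<rho> *\<^sub>R (R *v x)" and "a \<equiv> spectral_norm A" and "\<tau> \<equiv> spectral_norm T"
  assumes r: "r = A *v x - \<rho> *\<^sub>R x + g + e"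
    and g: "norm g \<le> \<epsilon> * a * norm x"
    and e: "norm e \<le> u * (norm (A *v x - \<rho> *\<^sub>R x) + norm g)"
    and y: "fl_vec u (x - T *v r) y"
    and u: "0 \<le> u" "2 * u < 1" and \<epsilon>: "0 \<le> \<epsilon>" and x: "sqrt a * norm x \<le> b * norm p"
  shows "norm (S *v y - \<rho> *\<^sub>R (R *v x))
    \<le> (spectral_norm (mat 1 - S ** T ** S) + gam 2 u * \<tau> * a + b * (u + (1 + gam 2 u) * \<epsilon> * \<tau> * a))
        * norm p"
proof -
  define q where "q = A *v x - \<rho> *\<^sub>R x"
  define s where "s = sqrt a"
  have a: "0 \<le> a" and \<tau>: "0 \<le> \<tau>"
    by (simp_all add: a_def \<tau>_def spectral_norm_nonneg)
  then have s: "0 \<le> s" "s * s = a"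
    by (simp_all add: s_def)
  have Sp: "q = S *v p"
    by (simp add: q_def p_def matrix_vector_mult_diff_distrib matrix_vector_mult_scaleR
        matrix_vector_mul_assoc S_S S_R)
  have norm_q: "norm q \<le> s * norm p"
    using norm_S_le[of p] by (simp add: Sp s_def a_def)
  define \<eta> where "\<eta> = y - (x - T *v r)"
  have r': "r = q + (g + e)"
    by (simp add: r q_def)
  have e': "norm e \<le> u * (norm q + norm g)"
    using e by (simp add: q_def)
  have ge: "norm (g + e) \<le> u * norm q + (1 + u) * norm g"
    using norm_triangle_ineq[of g e] e' by (simp add: algebra_simps)
  have norm_r: "norm r \<le> (1 + u) * norm q + (1 + u) * norm g"
    using norm_triangle_ineq[of q "g + e"] ge by (simp add: r' algebra_simps)
  have \<eta>: "norm \<eta> \<le> u * (norm x + \<tau> * ((1 + u) * norm q + (1 + u) * norm g))"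
  proof -
    have "norm \<eta> \<le> u * norm (x - T *v r)"
      unfolding \<eta>_def by (rule norm_fl_vec_error[OF y])
    also have "\<dots> \<le> u * (norm x + norm (T *v r))"
      using u by (intro mult_left_mono norm_triangle_ineq4)
    also have "\<dots> \<le> u * (norm x + \<tau> * ((1 + u) * norm q + (1 + u) * norm g))"
      unfolding \<tau>_def using u norm_r by (intro mult_left_mono add_left_mono spectral_norm_mult_vec_le)
    finally show ?thesis .
  qed
  have "S *v y - \<rho> *\<^sub>R (R *v x)
      = (mat 1 - S ** T ** S) *v p - S *v (T *v (g + e)) + S *v \<eta>"
    by (simp add: \<eta>_def r' Sp p_def matrix_vector_mult_diff_distrib matrix_vector_right_distrib
        matrix_vector_mult_diff_rdistrib algebra_simps flip: matrix_vector_mul_assoc)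
  then have "norm (S *v y - \<rho> *\<^sub>R (R *v x))
      \<le> norm ((mat 1 - S ** T ** S) *v p) + norm (S *v (T *v (g + e))) + norm (S *v \<eta>)"
    using norm_triangle_ineq[of "(mat 1 - S ** T ** S) *v p - S *v (T *v (g + e))" "S *v \<eta>"]
      norm_triangle_ineq4[of "(mat 1 - S ** T ** S) *v p" "S *v (T *v (g + e))"] by simp
  also have "\<dots> \<le> spectral_norm (mat 1 - S ** T ** S) * norm p
      + s * (\<tau> * (u * norm q + (1 + u) * norm g))
      + s * (u * (norm x + \<tau> * ((1 + u) * norm q + (1 + u) * norm g)))"
  proof (intro add_mono norm_mult_vec_le)
    show "norm (S *v (T *v (g + e))) \<le> s * (\<tau> * (u * norm q + (1 + u) * norm g))"
      using norm_S_le[of "T *v (g + e)"] mult_left_mono[OF spectral_norm_mult_vec_le[OF ge, of T] s(1)]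
      by (simp add: s_def a_def \<tau>_def)
    show "norm (S *v \<eta>) \<le> s * (u * (norm x + \<tau> * ((1 + u) * norm q + (1 + u) * norm g)))"
      using norm_S_le[of \<eta>] mult_left_mono[OF \<eta> s(1)] by (simp add: s_def a_def)
  qed
  also have "\<dots> = spectral_norm (mat 1 - S ** T ** S) * norm p
      + (u * (2 + u)) * (\<tau> * (s * norm q)) + u * (s * norm x) + (1 + u * (2 + u)) * (\<tau> * (s * norm g))"
    by (simp add: algebra_simps)
  also have "\<dots> \<le> spectral_norm (mat 1 - S ** T ** S) * norm p
      + gam 2 u * (\<tau> * (a * norm p)) + u * (b * norm p) + (1 + gam 2 u) * (\<tau> * (\<epsilon> * a * (b * norm p)))"
  proof -
    have gam: "u * (2 + u) \<le> gam 2 u"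
    proof -
      have "u * ((2 + u) * (1 - 2 * u)) \<le> u * 2"
        using u by (intro mult_left_mono) (auto simp: algebra_simps)
      then show ?thesis
        using u by (simp add: gam_def pos_le_divide_eq mult_ac)
    qed
    have uu: "0 \<le> u * (2 + u)"
      using u by simp
    have "s * norm q \<le> a * norm p"
      using mult_left_mono[OF norm_q s(1)] s(2) by (simp flip: mult.assoc)
    then have "\<tau> * (s * norm q) \<le> \<tau> * (a * norm p)"
      using \<tau> by (rule mult_left_mono)
    moreover have "0 \<le> gam 2 u" "0 \<le> \<tau> * (s * norm q)"
      using gam uu \<tau> s(1) by (linarith, simp)
    ultimately have 1: "u * (2 + u) * (\<tau> * (s * norm q)) \<le> gam 2 u * (\<tau> * (a * norm p))"
      using mult_mono[OF gam] by blast
    have 2: "u * (s * norm x) \<le> u * (b * norm p)"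
      using x u by (intro mult_left_mono) (auto simp: s_def)
    have "s * norm g \<le> \<epsilon> * a * (s * norm x)"
      using mult_left_mono[OF g s(1)] by (simp add: mult_ac)
    also have "\<dots> \<le> \<epsilon> * a * (b * norm p)"
      using x \<epsilon> a by (intro mult_left_mono) (auto simp: s_def)
    finally have "\<tau> * (s * norm g) \<le> \<tau> * (\<epsilon> * a * (b * norm p))"
      using \<tau> by (rule mult_left_mono)
    moreover have "0 \<le> 1 + gam 2 u" "0 \<le> \<tau> * (s * norm g)"
      using gam uu \<tau> s(1) by (linarith, simp)
    ultimately have 3:
      "(1 + u * (2 + u)) * (\<tau> * (s * norm g)) \<le> (1 + gam 2 u) * (\<tau> * (\<epsilon> * a * (b * norm p)))"
      using mult_mono[OF add_left_mono[OF gam, of 1]] by blast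
    show ?thesis
      using 1 2 3 by linarith
  qed
  also have "\<dots> = (spectral_norm (mat 1 - S ** T ** S) + gam 2 u * \<tau> * a
      + b * (u + (1 + gam 2 u) * \<epsilon> * \<tau> * a)) * norm p"
    by (simp add: algebra_simps)
  finally show ?thesis .
qed

end

theorem theorem2:
  fixes A T\<^sub>E :: "real ^ 'n ^ 'n"
    and x r w x' :: "real ^ 'n"
    and lam :: "nat \<Rightarrow> real"
    and u \<epsilon>\<^sub>A \<epsilon>\<^sub>r \<beta> \<gamma> :: real
    and n :: nat
  assumes n_def: "n = CARD('n)" and "2 \<le> n"
    and "spd A"
    and "eigenvalues A lam"
    and "0 < lam 1" and "lam 1 < lam 2" and "\<And>j. 2 \<le> j \<Longrightarrow> j < n \<Longrightarrow> lam j \<le> lam (Suc j)"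
    and "x \<noteq> 0"
    and "0 < u" and "2 * real n * u < 1"
    and "fl_residual u \<epsilon>\<^sub>A A x r"
    and "w = T\<^sub>E *v r"
    and "fl_vec u (x - w) x'"
    and "\<epsilon>\<^sub>r = (gam n u + \<epsilon>\<^sub>A + gam n u * \<epsilon>\<^sub>A + (real n + 1) * u) * ((1 + u) / (1 - 2 * real n * u))
                + \<epsilon>\<^sub>A + u"
    and "\<beta> = max (sqrt (lam 1 * lam n) / (rayleigh A x - lam 1))
                   (sqrt (lam 2 * lam n) / (lam 2 - rayleigh A x))"
    and "\<gamma> = spectral_norm (mat 1 - spd_sqrt A ** T\<^sub>E ** spd_sqrt A)
              + gam 2 u * spectral_norm T\<^sub>E * spectral_norm A
              + \<beta> * (u + (1 + gam 2 u) * \<epsilon>\<^sub>r * spectral_norm T\<^sub>E * spectral_norm A)"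
    and "lam 1 < rayleigh A x" and "rayleigh A x < lam 2"
    and "\<gamma> < 1"
  shows "x' \<noteq> 0 \<and> rayleigh A x' < lam 2 \<and>
    (rayleigh A x' - lam 1) / (lam 2 - rayleigh A x')
      \<le> (\<gamma> + (1 - \<gamma>) * (lam 1 / lam 2))\<^sup>2 * ((rayleigh A x - lam 1) / (lam 2 - rayleigh A x))"
proof -
  have sym: "transpose A = A"
    using \<open>spd A\<close> by (simp add: spd_def)
  have n: "2 \<le> CARD('n)"
    using assms(1,2) by simp
  obtain P d i where P: "orthogonal_matrix P" and A: "A = spectral_fun P d"
    and d: "d i = lam 1" "\<And>j. j \<noteq> i \<Longrightarrow> lam 2 \<le> d j" and d_le: "\<And>j. d j \<le> lam CARD('n)"
    using eigenvalues_diagonalization[OF sym \<open>eigenvalues A lam\<close> n \<open>lam 1 < lam 2\<close>] assms(7)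
    unfolding n_def by blast
  interpret G: spd_gap P d i "lam 1" "lam 2"
    using P d \<open>0 < lam 1\<close> \<open>lam 1 < lam 2\<close> by unfold_locales
  have GA: "G.A = A"
    by (simp add: G.A_def A)
  have GS: "G.S = spd_sqrt A"
    by (simp add: G.S_def A spd_sqrt_spectral_fun[OF P G.d_pos])
  define \<rho> where "\<rho> = rayleigh A x"
  define p where "p = G.S *v x - \<rho> *\<^sub>R (G.R *v x)"
  have u: "0 \<le> u" "2 * u < 1"
  proof -
    have "2 * u \<le> 2 * real n * u"
      using \<open>0 < u\<close> \<open>2 \<le> n\<close> by simp
    then show "0 \<le> u" "2 * u < 1"
      using \<open>0 < u\<close> \<open>2 * real n * u < 1\<close> by linarith+
  qed
  have \<rho>: "lam 1 < \<rho>" "\<rho> < lam 2"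
    using assms by (simp_all add: \<rho>_def)
  have A_pos: "0 < spectral_norm A"
    using abs_rayleigh_le[of A x] \<rho> \<open>0 < lam 1\<close> by (simp add: \<rho>_def)
  have \<epsilon>\<^sub>A: "0 \<le> \<epsilon>\<^sub>A"
  proof -
    obtain E :: "real ^ 'n ^ 'n" where "spectral_norm E \<le> \<epsilon>\<^sub>A * spectral_norm A"
      using \<open>fl_residual u \<epsilon>\<^sub>A A x r\<close> unfolding fl_residual_def fl_matvec_def by blast
    then have "0 \<le> \<epsilon>\<^sub>A * spectral_norm A"
      using spectral_norm_nonneg[of E] by linarith
    then show ?thesis
      using A_pos by (simp add: zero_le_mult_iff)
  qed
  have gam: "0 \<le> gam n u" "0 \<le> gam 2 u"
    using u \<open>2 * real n * u < 1\<close> by (simp_all add: gam_def)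
  have \<epsilon>\<^sub>r: "0 \<le> \<epsilon>\<^sub>r"
    using \<epsilon>\<^sub>A gam u \<open>2 * real n * u < 1\<close> unfolding assms(14)
    by (intro add_nonneg_nonneg mult_nonneg_nonneg divide_nonneg_nonneg) auto
  have lam_n: "0 \<le> lam n" "spectral_norm A \<le> lam n"
    using A_pos G.spectral_norm_A_le[OF d_le] by (simp_all add: GA n_def)
  have \<beta>: "0 \<le> \<beta>"
    using \<rho> lam_n \<open>0 < lam 1\<close> unfolding assms(15) \<rho>_def[symmetric] by (simp add: le_max_iff_disj)
  have "sqrt (spectral_norm A) * norm x \<le> sqrt (lam n) * norm x"
    using lam_n by (intro mult_right_mono) auto
  also have "\<dots> \<le> \<beta> * norm p"
    using G.norm_le_scaled_residual[OF \<rho> lam_n(1), of x]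
    unfolding assms(15) p_def \<rho>_def[symmetric] by (simp add: mult_ac)
  finally have norm_x: "sqrt (spectral_norm G.A) * norm x \<le> \<beta> * norm p"
    by (simp only: GA)
  obtain g e where r: "r = A *v x - \<rho> *\<^sub>R x + g + e"
    and g: "norm g \<le> \<epsilon>\<^sub>r * spectral_norm A * norm x"
    and e: "norm e \<le> u * (norm (A *v x - \<rho> *\<^sub>R x) + norm g)"
    using fl_residual_error[OF \<open>fl_residual u \<epsilon>\<^sub>A A x r\<close> \<open>x \<noteq> 0\<close> u(1)] \<open>2 * real n * u < 1\<close>
    unfolding assms(14) \<rho>_def n_def by metis
  have "norm (G.S *v x' - \<rho> *\<^sub>R (G.R *v x)) \<le> \<gamma> * norm p"
    using G.computed_step_in_ball[of r x \<rho> g e \<epsilon>\<^sub>r u T\<^sub>E x' \<beta>] r g e \<open>fl_vec u (x - w) x'\<close> u \<epsilon>\<^sub>r norm_x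
    unfolding GA p_def assms(12,16) GS by blast
  moreover have "0 \<le> \<gamma>"
    using spectral_norm_nonneg[of T\<^sub>E] spectral_norm_nonneg[of "mat 1 - spd_sqrt A ** T\<^sub>E ** spd_sqrt A"]
      A_pos gam \<beta> u \<epsilon>\<^sub>r unfolding assms(16)
    by (intro add_nonneg_nonneg mult_nonneg_nonneg) auto
  ultimately show ?thesis
    using G.pinvit_contraction[of x x' \<gamma>] \<open>x \<noteq> 0\<close> \<rho> \<open>\<gamma> < 1\<close> by (simp add: GA \<rho>_def p_def)
qed

end
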